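(* Let $\alpha$ and $\beta$ be weak compositions of length $n$. Then \[\mathfrak{F}_\alpha\cdot\tilde{\mathcal{A}}_\beta=\sum_{D\in\operatorname{qSSet}(\alpha,\beta)}\tilde{\mathcal{A}}_{\operatorname{Des}(D)}.\]
   Context: Weak composition of length $n$: $\alpha\in\mathbb{Z}_{\ge0}^n$; $x^\alpha=\prod x_i^{\alpha_i}$. $\operatorname{flat}(\alpha)$: move all zeros of $\alpha$ to the right end, keeping order of nonzero entries (as a strong composition, drop the zeros). Dominance: $\gamma\trianglelefteq\delta$ iff $\gamma_1+\cdots+\gamma_j\le\delta_1+\cdots+\delta_j$ for all $j$. Refinement: for strong compositions $\mu,\nu$, $\mu\succcurlyeq\nu$ iff each part of $\nu$ is a sum of consecutive parts of $\mu$ (in order, using all parts of $\mu$). Operators: $S_n$ acts on length-$n$ vectors with $s_i$ swapping positions $i,i+1$; $w_\alpha$ is a minimal length permutation with $w_\alpha(\alpha)=\operatorname{flat}(\alpha)$. $\tilde{s}_i(\gamma)$ swaps positions $i,i+1$ if $\gamma_i=0$ or $\gamma_{i+1}=0$ and fixes $\gamma$ otherwise. $\tilde{\pi}_i(x^\gamma)=\dfrac{x_ix^\gamma-x_{i+1}x^{\tilde{s}_i(\gamma)}}{x_i-x_{i+1}}$ (extended linearly), $\tilde{\theta}_i=\tilde{\pi}_i-1$; for reduced $w=s_{i_1}\cdots s_{i_k}$, $\tilde{\pi}_w=\tilde{\pi}_{i_1}\cdots\tilde{\pi}_{i_k}$ and $\tilde{\theta}_w=\tilde{\theta}_{i_1}\cdots\tilde{\theta}_{i_k}$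 (independent of reduced word). Fundamental slide polynomial $\mathfrak{F}_\alpha=\tilde{\pi}_{w_\alpha^{-1}}x^{\operatorname{flat}(\alpha)}$; fundamental Demazure atom $\tilde{\mathcal{A}}_\alpha=\tilde{\theta}_{w_\alpha^{-1}}x^{\operatorname{flat}(\alpha)}$. Fundamental shift: for $v\in\mathbb{Z}_{\ge0}^n$ with nonzero positions $S=\{i_1<\cdots<i_k\}$, $\operatorname{qshift}(v)=(w_1,\ldots,w_n)$ with: (1) for $j\in S$, $w_j=v_j$ if $j=1$ or $j-1\in S$, else $w_j=1$; (2) if $i_j\in S$, $j<k$, $i_j+1\notin S$, then $w_{i_j+1}=v_{i_{j+1}}-1$; (3) if $1\notin S\neq\emptyset$, $w_1=v_{i_1}-1$; (4) other $w_j=0$. Words: let $A=(2n-1)^{\alpha_1}(2n-3)^{\alpha_2}\cdots 3^{\alpha_{n-1}}1^{\alpha_n}$ and $B=(2n)^{\beta_1}(2n-2)^{\beta_2}\cdots4^{\beta_{n-1}}2^{\beta_n}$ (exponents denote repetition). For a word $D$ in positive integers and the symbol $*$, its runs are: each occurrence of $*$ is a run containing no letters, and the remaining maximal factors of consecutive integer letters are cut at every strict descent (a letter strictly larger than the next) into weakly increasing runs. $\operatorname{Des}(D)$ is the vector of numbers of letters in the runs (in order), $\operatorname{Des}_A(D)$ (resp. $\operatorname{Des}_B(D)$) the vector counting odd (resp. even) letters in each run. $\operatorname{qSSet}(\alpha,\beta)$ is the set of words $D$ such that: $D$ is a shuffle of $A$, $B$ and $k$ copies of $*$, with $k$ such that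 $D$ has exactly $n$ runs; whenever $D$ has a consecutive factor $c*\cdots*d$ ($c,d$ integers, at least one $*$) then $c>d$; $\operatorname{flat}(\operatorname{Des}_A(D))\succcurlyeq\operatorname{flat}(\alpha)$ and $\operatorname{Des}_A(D)\trianglerighteq\alpha$; and $\operatorname{qshift}(\beta)\trianglerighteq\operatorname{Des}_B(D)\trianglerighteq\beta$. *)

theory Defs
  imports
    "HOL-Library.Poly_Mapping"
    "HOL-Combinatorics.Permutations"
begin

text \<open>
  A weak composition of length \<open>n\<close> is a \<^typ>\<open>nat list\<close> of length \<open>n\<close>. Positions, variables and the
  generators \<open>s\<^sub>i\<close> are numbered from 0: position \<open>i\<close> here is position \<open>i + 1\<close> in the usual
  one-based convention, and \<open>s\<^sub>i\<close> (with \<open>i + 1 < n\<close>) exchanges positions \<open>i\<close> and \<open>i + 1\<close>.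
\<close>

definition strong :: "nat list \<Rightarrow> nat list" where
  "strong \<alpha> = filter (\<lambda>a. a \<noteq> 0) \<alpha>"

definition flat :: "nat list \<Rightarrow> nat list" where
  "flat \<alpha> = strong \<alpha> @ filter (\<lambda>a. a = 0) \<alpha>"

text \<open>Dominance (\<open>dominated \<gamma> \<delta>\<close> means that \<open>\<delta>\<close> dominates \<open>\<gamma>\<close>) is only used for vectors
  of equal length; equality of the total sums is not demanded.\<close>

definition dominated :: "nat list \<Rightarrow> nat list \<Rightarrow> bool" where
  "dominated \<gamma> \<delta> \<longleftrightarrow> (\<forall>j \<le> length \<gamma>. sum_list (take j \<gamma>) \<le> sum_list (take j \<delta>))"

definition refines :: "nat list \<Rightarrow> nat list \<Rightarrow> bool" where
  "refines \<mu> \<nu> \<longleftrightarrow> (\<exists>\<mu>s. concat \<mu>s = \<mu> \<and> map sum_list \<mu>s = \<nu>)"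


subsection \<open>Permutations and reduced words\<close>

text \<open>Left action on vectors: the entry at position \<open>i\<close> moves to position \<open>w i\<close>.\<close>

definition act :: "(nat \<Rightarrow> nat) \<Rightarrow> nat list \<Rightarrow> nat list" where
  "act w \<alpha> = permute_list (inv w) \<alpha>"

definition word_perm :: "nat list \<Rightarrow> nat \<Rightarrow> nat" where
  "word_perm is = foldr (\<lambda>i w. transpose i (Suc i) \<circ> w) is id"

definition word_for :: "nat \<Rightarrow> (nat \<Rightarrow> nat) \<Rightarrow> nat list \<Rightarrow> bool" where
  "word_for n w is \<longleftrightarrow> (\<forall>i \<in> set is. Suc i < n) \<and> word_perm is = w"

definition reduced_word :: "nat \<Rightarrow> (nat \<Rightarrow> nat) \<Rightarrow> nat list \<Rightarrow> bool" where
  "reduced_word n w is \<longleftrightarrow> is_arg_min length (word_for n w) is"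

definition perm_length :: "nat \<Rightarrow> (nat \<Rightarrow> nat) \<Rightarrow> nat" where
  "perm_length n w = (LEAST k. \<exists>is. word_for n w is \<and> length is = k)"

definition sorting_perm :: "nat list \<Rightarrow> nat \<Rightarrow> nat" where
  "sorting_perm \<alpha> =
     arg_min (perm_length (length \<alpha>)) (\<lambda>w. w permutes {..<length \<alpha>} \<and> act w \<alpha> = flat \<alpha>)"


subsection \<open>Polynomials and operators\<close>

text \<open>Polynomials with integer coefficients in the variables \<open>x\<^sub>0, x\<^sub>1, \<dots>\<close>: finitely supported maps
  from exponent vectors to \<^typ>\<open>int\<close>. Thus \<open>frag_of m\<close> is the monomial with exponent vector \<open>m\<close>,
  and \<open>frag_extend\<close> extends a map on monomials linearly.\<close>

type_synonym poly = "(nat \<Rightarrow>\<^sub>0 nat) \<Rightarrow>\<^sub>0 int"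

definition var :: "nat \<Rightarrow> poly" where
  "var i = frag_of (Poly_Mapping.single i 1)"

definition monomial_of :: "nat list \<Rightarrow> poly" where
  "monomial_of \<gamma> = frag_of (Poly_Mapping.nth \<gamma>)"

definition qswap :: "nat \<Rightarrow> (nat \<Rightarrow>\<^sub>0 nat) \<Rightarrow> (nat \<Rightarrow>\<^sub>0 nat)" where
  "qswap i m =
     (if Poly_Mapping.lookup m i = 0 \<or> Poly_Mapping.lookup m (Suc i) = 0
      then Poly_Mapping.map_key (transpose i (Suc i)) m else m)"

text \<open>The quotient defining \<open>\<pi>\<^sub>i\<close> on a monomial is a polynomial; it is unique because the polynomial
  ring has no zero divisors.\<close>

definition qpi_monomial :: "nat \<Rightarrow> (nat \<Rightarrow>\<^sub>0 nat) \<Rightarrow> poly" where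
  "qpi_monomial i m =
     (THE q. (var i - var (Suc i)) * q
             = var i * frag_of m - var (Suc i) * frag_of (qswap i m))"

definition qpi :: "nat \<Rightarrow> poly \<Rightarrow> poly" where
  "qpi i = frag_extend (qpi_monomial i)"

definition qtheta :: "nat \<Rightarrow> poly \<Rightarrow> poly" where
  "qtheta i f = qpi i f - f"

text \<open>The choice of the reduced word in the next two definitions is immaterial.\<close>

definition qpi_perm :: "nat \<Rightarrow> (nat \<Rightarrow> nat) \<Rightarrow> poly \<Rightarrow> poly" where
  "qpi_perm n w = foldr qpi (SOME is. reduced_word n w is)"

definition qtheta_perm :: "nat \<Rightarrow> (nat \<Rightarrow> nat) \<Rightarrow> poly \<Rightarrow> poly" where
  "qtheta_perm n w = foldr qtheta (SOME is. reduced_word n w is)"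

definition fundamental_slide :: "nat list \<Rightarrow> poly" where
  "fundamental_slide \<alpha> =
     qpi_perm (length \<alpha>) (inv (sorting_perm \<alpha>)) (monomial_of (flat \<alpha>))"

definition fundamental_atom :: "nat list \<Rightarrow> poly" where
  "fundamental_atom \<alpha> =
     qtheta_perm (length \<alpha>) (inv (sorting_perm \<alpha>)) (monomial_of (flat \<alpha>))"


subsection \<open>Fundamental shift\<close>

definition qshift :: "nat list \<Rightarrow> nat list" where
  "qshift v =
     (let S = {i. i < length v \<and> v ! i \<noteq> 0} in
      map (\<lambda>j.
        if j \<in> S then (if j = 0 \<or> j - 1 \<in> S then v ! j else 1)
        else if j = 0 \<and> S \<noteq> {} then v ! Min S - 1
        else if j \<noteq> 0 \<and> j - 1 \<in> S \<and> (\<exists>i \<in> S. j < i) then v ! Min {i \<in> S. j < i} - 1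
        else 0) [0..<length v])"


subsection \<open>Words\<close>

text \<open>Words are over positive integers (\<^term>\<open>Some a\<close>) and the symbol \<open>*\<close> (\<^term>\<open>None\<close>).\<close>

type_synonym word = "nat option list"

definition A_word :: "nat list \<Rightarrow> word" where
  "A_word \<alpha> = (let n = length \<alpha> in
     concat (map (\<lambda>i. replicate (\<alpha> ! i) (Some (2 * (n - i) - 1))) [0..<n]))"

definition B_word :: "nat list \<Rightarrow> word" where
  "B_word \<beta> = (let n = length \<beta> in
     concat (map (\<lambda>i. replicate (\<beta> ! i) (Some (2 * (n - i)))) [0..<n]))"

fun runs :: "word \<Rightarrow> nat list list" where
  "runs [] = []"
| "runs (None # D) = [] # runs D"
| "runs (Some a # Some b # D) =
     (if a \<le> b then (a # hd (runs (Some b # D))) # tl (runs (Some b # D))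
      else [a] # runs (Some b # D))"
| "runs (Some a # D) = [a] # runs D"

definition Des :: "word \<Rightarrow> nat list" where
  "Des D = map length (runs D)"

definition Des_A :: "word \<Rightarrow> nat list" where
  "Des_A D = map (\<lambda>r. length (filter odd r)) (runs D)"

definition Des_B :: "word \<Rightarrow> nat list" where
  "Des_B D = map (\<lambda>r. length (filter even r)) (runs D)"

definition star_descents :: "word \<Rightarrow> bool" where
  "star_descents D \<longleftrightarrow>
     (\<forall>U V c d k. D = U @ Some c # replicate k None @ Some d # V \<and> k \<ge> 1 \<longrightarrow> c > d)"

text \<open>The set is finite, since every \<open>*\<close> contributes a run and there are exactly \<open>n\<close> runs.\<close>

definition qSSet :: "nat list \<Rightarrow> nat list \<Rightarrow> word set" where
  "qSSet \<alpha> \<beta> = {D.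
     (\<exists>k. \<exists>C \<in> shuffles (A_word \<alpha>) (B_word \<beta>). D \<in> shuffles C (replicate k None)) \<and>
     length (runs D) = length \<alpha> \<and>
     star_descents D \<and>
     refines (strong (Des_A D)) (strong \<alpha>) \<and>
     dominated \<alpha> (Des_A D) \<and>
     dominated (Des_B D) (qshift \<beta>) \<and>
     dominated \<beta> (Des_B D)}"

end

theory Submission
  imports Defs "HOL-Library.Product_Lexorder" "HOL-Library.Multiset"
begin

text \<open>
  Along a reduced word of a sorting permutation every generator moves a nonzero entry past a zero.
  Following the operators through such steps gives multiplicity-free expansions:
  \<open>x\<^sup>g\<close> occurs in the atom of \<open>v\<close> iff at each nonzero position of \<open>v\<close> the partial sums of \<open>g\<close> and \<open>v\<close> agree and \<open>g\<close> is nonzero, and it occurs in the slide polynomial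
  iff every partial sum of \<open>v\<close> is already attained by \<open>g\<close>, no later.

  A pair of monomials from the two factors places the letters of \<open>A\<close> and \<open>B\<close> at positions. Listing
  all letters by position, and increasingly within a position, turns the pair into one sorted list of
  pairs (position, letter). Pushing every letter to the position of the last letter of its weakly
  increasing run yields the word \<open>D\<close>: its runs are the nonempty positions, the stars are the empty
  ones. The positions which push to a given \<open>D\<close> are exactly the monomials of the atom of
  \<open>Des D\<close>, and pushing preserves and reflects the position bounds that define both factors.
\<close>

subsection \<open>Partial sums\<close>

text \<open>The letter codes decide why pushing suits both factors. The part index is antitone in
  the letter, and pushing takes a letter to the place of one at least as large, whose position bound
  is no larger; so all upper bounds survive. An atom asks in addition that each of its parts keeps a
  letter at its own position. Reading this back from a pushed filling requires that no larger letter
  has the same part index, which holds for \<open>2 * (n - p)\<close> and fails for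
  \<open>2 * (n - p) - 1\<close>. Hence the atom factor \<open>\<beta>\<close> receives the even
  letters. On the operator side the obstacle is signs: \<open>qtheta i\<close> turns a monomial with
  a nonzero entry only at \<open>Suc i\<close> into a negative sum. Atoms avoid such monomials in
  every step that occurs; for slide polynomials these terms cancel in pairs.\<close>

abbreviation psum :: "nat list \<Rightarrow> nat \<Rightarrow> nat" where
  "psum g j \<equiv> sum_list (take j g)"

lemma psum_Suc: "j < length g \<Longrightarrow> psum g (Suc j) = psum g j + g ! j"
  by (simp add: take_Suc_conv_app_nth)

lemma psum_mono: "i \<le> j \<Longrightarrow> psum g i \<le> psum g j"
proof -
  assume "i \<le> j"
  then have "take j g = take i g @ take (j - i) (drop i g)"
    by (metis le_add_diff_inverse take_add)
  then show ?thesis by simp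
qed

lemma psum_le: "psum g j \<le> sum_list g"
  by (metis append_take_drop_id le_add1 sum_list_append)

lemma psum_eqI:
  assumes "length g = length v" and "\<And>j. j \<le> length v \<Longrightarrow> psum g j = psum v j"
  shows "g = v"
proof (rule nth_equalityI)
  fix i assume i: "i < length g"
  have "psum g i + g ! i = psum v i + v ! i"
    using i assms(1) assms(2)[of "Suc i"] by (simp add: psum_Suc)
  then show "g ! i = v ! i" using assms(2)[of i] i assms(1) by simp
qed (rule assms(1))

lemma update_two_conv:
  assumes "Suc i < length g"
  shows "g[i := a, Suc i := b] = take i g @ [a, b] @ drop (Suc (Suc i)) g"
  using assms by (simp add: upd_conv_take_nth_drop take_Suc_conv_app_nth Suc_lessD)

text \<open>Redistributing mass between two neighbours is visible only in the partial sum that ends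
  between them. Both elementary moves, \<open>spread\<close> and \<open>adjswap\<close>, are of this
  kind.\<close>

lemma psum_update_two:
  assumes "Suc i < length g" and "a + b = g ! i + g ! Suc i"
  shows "psum (g[i := a, Suc i := b]) j = (if j = Suc i then psum g i + a else psum g j)"
proof -
  have g: "g = take i g @ [g ! i, g ! Suc i] @ drop (Suc (Suc i)) g"
    using update_two_conv[OF assms(1), of "g ! i" "g ! Suc i"] by simp
  have len: "length (take i g) = i" using assms(1) by simp
  consider "j \<le> i" | "j = Suc i" | k where "j = i + 2 + k"
    using that(3)[of "j - (i + 2)"] by linarith
  then show ?thesis
  proof cases
    case 1
    then show ?thesis by simp
  next
    case 2
    then show ?thesis using update_two_conv[OF assms(1), of a b] len by simp
  next
    case 3
    have "psum (xs @ [c, d] @ ys) j = sum_list xs + (c + d) + psum ys k"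
      if "length xs = i" for xs ys :: "nat list" and c d
      using that 3 by simp
    from this[OF len] have "psum (take i g @ [a, b] @ drop (Suc (Suc i)) g) j
        = psum (take i g @ [g ! i, g ! Suc i] @ drop (Suc (Suc i)) g) j"
      using assms(2) by metis
    then have "psum (g[i := a, Suc i := b]) j = psum g j"
      by (simp only: update_two_conv[OF assms(1)] g[symmetric])
    then show ?thesis using 3 by simp
  qed
qed

lemma sum_list_update_two:
  fixes g :: "nat list"
  assumes "Suc i < length g" and "a + b = g ! i + g ! Suc i"
  shows "sum_list (g[i := a, Suc i := b]) = sum_list g"
  using psum_update_two[OF assms, of "length g"] assms(1) by simp

subsection \<open>The operators on monomials\<close>

lemma frag_of_mult: "frag_of m * frag_of m' = frag_of (m + m')"
  by (simp add: mult_single)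

lemma var_power: "var i ^ c = frag_of (Poly_Mapping.single i c)"
  by (induction c) (simp_all add: var_def mult_single single_add[symmetric])

lemma monomial_of_update_two:
  assumes "Suc i < length g"
  shows "monomial_of (g[i := c, Suc i := d])
    = monomial_of (g[i := 0, Suc i := 0]) * (var i ^ c * var (Suc i) ^ d)"
proof -
  have "Poly_Mapping.nth (g[i := c, Suc i := d])
      = Poly_Mapping.nth (g[i := 0, Suc i := 0])
        + (Poly_Mapping.single i c + Poly_Mapping.single (Suc i) d)"
    by (rule poly_mapping_eqI)
      (use assms in \<open>auto simp: lookup_add lookup_single nth_default_def nth_list_update when_def\<close>)
  then show ?thesis
    by (simp add: monomial_of_def var_power frag_of_mult)
qed

lemma qswap_nth:
  assumes "Suc i < length g" and "g ! i = 0 \<or> g ! Suc i = 0"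
  shows "frag_of (qswap i (Poly_Mapping.nth g)) = monomial_of (g[i := g ! Suc i, Suc i := g ! i])"
proof -
  have "qswap i (Poly_Mapping.nth g) = Poly_Mapping.nth (g[i := g ! Suc i, Suc i := g ! i])"
    by (rule poly_mapping_eqI)
      (use assms in \<open>auto simp: qswap_def map_key.rep_eq nth_default_def nth_list_update
         transpose_def\<close>)
  then show ?thesis by (simp add: monomial_of_def)
qed

lemma var_neq: "var i \<noteq> var j" if "i \<noteq> j"
  proof
  assume "var i = var j"
  then have "Poly_Mapping.single i (1::nat) = Poly_Mapping.single j 1"
    by (simp add: var_def frag_of_eq)
  from arg_cong[OF this, of "\<lambda>m. Poly_Mapping.lookup m i"] show False
    using that by (simp add: lookup_single)
qed

text \<open>Cancelling the nonzero factor \<open>var i - var (Suc i)\<close> in the integral domain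
  \<open>poly\<close> makes the quotient unique, so exhibiting one solution evaluates the definite
  description.\<close>

lemma qpi_monomial_of_eqI:
  assumes "(var i - var (Suc i)) * q
    = var i * monomial_of g - var (Suc i) * frag_of (qswap i (Poly_Mapping.nth g))"
  shows "qpi i (monomial_of g) = q"
proof -
  have "qpi_monomial i (Poly_Mapping.nth g) = q"
    unfolding qpi_monomial_def
  proof (rule the_equality)
    show "(var i - var (Suc i)) * q = var i * frag_of (Poly_Mapping.nth g)
        - var (Suc i) * frag_of (qswap i (Poly_Mapping.nth g))"
      using assms by (simp add: monomial_of_def)
    fix q' assume "(var i - var (Suc i)) * q' = var i * frag_of (Poly_Mapping.nth g)
        - var (Suc i) * frag_of (qswap i (Poly_Mapping.nth g))"
    then have "(var i - var (Suc i)) * q' = (var i - var (Suc i)) * q"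
      using assms by (simp add: monomial_of_def)
    then show "q' = q" using var_neq[of i "Suc i"] by (simp only: mult_cancel_left) simp
  qed
  then show ?thesis by (simp add: qpi_def monomial_of_def)
qed

lemma qtheta_monomial_both:
  assumes "Suc i < length g" and "g ! i \<noteq> 0" and "g ! Suc i \<noteq> 0"
  shows "qtheta i (monomial_of g) = 0"
proof -
  have "qswap i (Poly_Mapping.nth g) = Poly_Mapping.nth g"
    using assms by (simp add: qswap_def nth_default_def)
  then have "qpi i (monomial_of g) = monomial_of g"
    by (intro qpi_monomial_of_eqI) (simp add: monomial_of_def algebra_simps)
  then show ?thesis by (simp add: qtheta_def)
qed

text \<open>Parametrised by the right entry: for \<open>d\<close> up to the total of the two entries
  this runs through all their distributions, and \<open>d = 0\<close> is the canonical
  representative.\<close>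

definition spread :: "nat \<Rightarrow> nat list \<Rightarrow> nat \<Rightarrow> nat list" where
  "spread i g d = g[i := g ! i + g ! Suc i - d, Suc i := d]"

lemma sum_powers:
  fixes X Y :: poly
  shows "(X - Y) * (\<Sum>d\<le>a. X ^ (a - d) * Y ^ d) = X ^ Suc a - Y ^ Suc a"
proof -
  have "(\<Sum>d\<le>a. X ^ (a - d) * Y ^ d) = (\<Sum>p<Suc a. X ^ p * Y ^ (a - p))"
    unfolding lessThan_Suc_atMost
    by (rule sum.reindex_bij_witness[of _ "\<lambda>d. a - d" "\<lambda>d. a - d"]) auto
  then show ?thesis
    using diff_power_eq_sum[of X a Y] by (simp add: mult.commute)
qed

text \<open>With right entry zero the quotient is, up to the other variables, the complete
  homogeneous polynomial of degree \<open>g ! i\<close> in the two variables; subtracting the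
  identity removes its term \<open>d = 0\<close>, the monomial itself.\<close>

lemma qtheta_monomial_left:
  assumes "Suc i < length g" and "g ! Suc i = 0"
  shows "qtheta i (monomial_of g) = (\<Sum>d = 1..g ! i. monomial_of (spread i g d))"
proof -
  define R where "R = monomial_of (g[i := 0, Suc i := 0])"
  define a where "a = g ! i"
  have mono: "monomial_of (spread i g d) = R * (var i ^ (a - d) * var (Suc i) ^ d)" for d
    using monomial_of_update_two[OF assms(1), of "a - d" d] assms(2)
    by (simp add: spread_def R_def a_def)
  have g: "g = spread i g 0"
    using assms by (simp add: spread_def) (metis list_update_id)
  have "frag_of (qswap i (Poly_Mapping.nth g)) = R * var (Suc i) ^ a"
    using qswap_nth[OF assms(1)] monomial_of_update_two[OF assms(1), of 0 a] assms(2)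
    by (simp add: R_def a_def)
  moreover have "monomial_of g = R * var i ^ a"
    using mono[of 0] g by simp
  moreover have "(var i - var (Suc i)) * (R * (\<Sum>d\<le>a. var i ^ (a - d) * var (Suc i) ^ d))
      = R * (var i ^ Suc a - var (Suc i) ^ Suc a)"
    by (simp only: sum_powers[symmetric] mult.left_commute)
  ultimately have "qpi i (monomial_of g)
      = R * (\<Sum>d\<le>a. var i ^ (a - d) * var (Suc i) ^ d)"
    by (intro qpi_monomial_of_eqI) (simp add: algebra_simps)
  also have "\<dots> = (\<Sum>d\<le>a. monomial_of (spread i g d))"
    by (simp add: mono sum_distrib_left)
  also have "{..a} = insert 0 {1..a}" by auto
  also have "(\<Sum>d\<in>insert 0 {1..a}. monomial_of (spread i g d))
      = monomial_of g + (\<Sum>d = 1..a. monomial_of (spread i g d))"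
    using g by simp
  finally show ?thesis by (simp add: qtheta_def a_def)
qed

text \<open>With a positive entry only on the right, the quotient is minus the terms in which both
  variables occur. Subtracting the identity supplies the missing pure power with the same
  sign.\<close>

lemma qtheta_monomial_right:
  assumes "Suc i < length g" and "g ! i = 0"
  shows "qtheta i (monomial_of g) = - (\<Sum>d = 1..g ! Suc i. monomial_of (spread i g d))"
proof (cases "g ! Suc i")
  case 0
  then show ?thesis using qtheta_monomial_left[OF assms(1)] assms(2) by simp
next
  case (Suc b)
  define R where "R = monomial_of (g[i := 0, Suc i := 0])"
  have mono: "monomial_of (spread i g d) = R * (var i ^ (Suc b - d) * var (Suc i) ^ d)" for d
    using monomial_of_update_two[OF assms(1), of "Suc b - d" d] assms(2) Suc
    by (simp add: spread_def R_def)
  have g: "g = spread i g (Suc b)"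
    using assms Suc by (simp add: spread_def) (metis list_update_id)
  have swap: "frag_of (qswap i (Poly_Mapping.nth g)) = R * var i ^ Suc b"
    using qswap_nth[OF assms(1)] monomial_of_update_two[OF assms(1), of "Suc b" 0] assms(2) Suc
    by (simp add: R_def)
  have mg: "monomial_of g = R * var (Suc i) ^ Suc b"
    using mono[of "Suc b"] g by simp
  define T where "T = (\<Sum>d\<le>b. var i ^ (b - d) * var (Suc i) ^ d)"
  have sum_eq: "(\<Sum>d = 1..Suc b. monomial_of (spread i g d)) = R * (var (Suc i) * T)"
  proof -
    have "(\<Sum>d = 1..Suc b. monomial_of (spread i g d))
        = (\<Sum>d\<le>b. monomial_of (spread i g (Suc d)))"
      by (rule sum.reindex_bij_witness[of _ Suc "\<lambda>d. d - 1"]) auto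
    then show ?thesis by (simp add: mono T_def sum_distrib_left mult_ac)
  qed
  have "(var i - var (Suc i)) * (monomial_of g - R * (var (Suc i) * T))
      = (var i - var (Suc i)) * monomial_of g
        - R * var (Suc i) * ((var i - var (Suc i)) * T)"
    by (simp add: algebra_simps)
  also have "\<dots> = var i * monomial_of g - var (Suc i) * (R * var i ^ Suc b)"
    unfolding T_def sum_powers mg by (simp add: algebra_simps)
  finally have "qpi i (monomial_of g) = monomial_of g - R * (var (Suc i) * T)"
    unfolding swap[symmetric] by (rule qpi_monomial_of_eqI)
  then show ?thesis by (simp only: qtheta_def Suc sum_eq) simp
qed

lemma qpi_sum: "finite X \<Longrightarrow> qpi i (\<Sum>x\<in>X. f x) = (\<Sum>x\<in>X. qpi i (f x))"
  by (simp add: qpi_def frag_extend_sum o_def)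

lemma qtheta_sum: "finite X \<Longrightarrow> qtheta i (\<Sum>x\<in>X. f x) = (\<Sum>x\<in>X. qtheta i (f x))"
  by (simp add: qtheta_def qpi_sum sum_subtractf)

lemma length_spread [simp]: "length (spread i g d) = length g"
  by (simp add: spread_def)

lemma spread_nth:
  assumes "Suc i < length g"
  shows "spread i g d ! j
    = (if j = i then g ! i + g ! Suc i - d else if j = Suc i then d else g ! j)"
  using assms by (auto simp: spread_def nth_list_update)

lemma psum_spread:
  assumes "Suc i < length g" and "d \<le> g ! i + g ! Suc i"
  shows "psum (spread i g d) j
    = (if j = Suc i then psum g i + (g ! i + g ! Suc i - d) else psum g j)"
  unfolding spread_def using assms by (subst psum_update_two) auto

lemma sum_list_spread:
  assumes "Suc i < length g" and "d \<le> g ! i + g ! Suc i"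
  shows "sum_list (spread i g d) = sum_list g"
  unfolding spread_def using assms by (intro sum_list_update_two) auto

lemma spread_spread:
  assumes "Suc i < length g" and "d \<le> g ! i + g ! Suc i"
  shows "spread i (spread i g d) e = spread i g e"
  by (rule nth_equalityI) (use assms in \<open>auto simp: spread_nth\<close>)

lemma spread_self: "Suc i < length g \<Longrightarrow> spread i g (g ! Suc i) = g"
  by (rule nth_equalityI) (auto simp: spread_nth)

text \<open>The antisymmetry behind the pairwise cancellation in
  \<open>qpi_slide_step\<close>.\<close>

lemma qtheta_swap_monomial:
  assumes "Suc i < length g" and "g ! i = 0"
  shows "qtheta i (monomial_of g) = - qtheta i (monomial_of (spread i g 0))"
proof -
  have "qtheta i (monomial_of (spread i g 0))
      = (\<Sum>d = 1..g ! Suc i. monomial_of (spread i (spread i g 0) d))"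
    using qtheta_monomial_left[of i "spread i g 0"] assms by (simp add: spread_nth)
  then show ?thesis
    using qtheta_monomial_right[OF assms] assms by (simp add: spread_spread)
qed

subsection \<open>Monomial expansions of slide polynomials and atoms\<close>

definition slide_set :: "nat list \<Rightarrow> nat list set" where
  "slide_set v = {g. length g = length v \<and> sum_list g = sum_list v \<and>
     (\<forall>i \<le> length v. \<exists>j \<le> i. psum g j = psum v i)}"

definition atom_set :: "nat list \<Rightarrow> nat list set" where
  "atom_set v = {g. length g = length v \<and> sum_list g = sum_list v \<and>
     (\<forall>i < length v. v ! i \<noteq> 0 \<longrightarrow> g ! i \<noteq> 0 \<and> psum g (Suc i) = psum v (Suc i))}"

abbreviation mono_sum :: "nat list set \<Rightarrow> poly" where
  "mono_sum X \<equiv> (\<Sum>g\<in>X. monomial_of g)"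

lemma finite_compositions: "finite {g :: nat list. length g = n \<and> sum_list g = N}"
  by (rule finite_subset[OF _ finite_lists_length_eq[of "{..N}" n]])
    (auto dest: member_le_sum_list)

lemma finite_slide_set: "finite (slide_set v)"
  by (rule finite_subset[OF _ finite_compositions[of "length v" "sum_list v"]])
    (auto simp: slide_set_def)

lemma finite_atom_set: "finite (atom_set v)"
  by (rule finite_subset[OF _ finite_compositions[of "length v" "sum_list v"]])
    (auto simp: atom_set_def)

lemma slide_set_psum_le:
  assumes "g \<in> slide_set v" and "i \<le> length v"
  shows "psum v i \<le> psum g i"
proof -
  obtain j where "j \<le> i" "psum g j = psum v i" using assms by (auto simp: slide_set_def)
  then show ?thesis using psum_mono[of j i g] by simp
qed

text \<open>A positive partial sum is reached at the last nonzero entry counted in it. The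
  conditions of \<open>atom_set\<close> are imposed at such positions only, and this carries them to
  all partial sums.\<close>

lemma psum_support:
  "psum v j = 0 \<or> (\<exists>k < j. k < length v \<and> v ! k \<noteq> 0 \<and> psum v (Suc k) = psum v j)"
proof (induction j)
  case (Suc j)
  show ?case
  proof (cases "j < length v \<and> v ! j \<noteq> 0")
    case True
    then show ?thesis by blast
  next
    case False
    then have "psum v (Suc j) = psum v j"
      by (cases "j < length v") (simp_all add: psum_Suc)
    then show ?thesis using Suc by (metis less_Suc_eq)
  qed
qed simp

lemma atom_set_subset_slide_set: "atom_set v \<subseteq> slide_set v"
proof
  fix g assume g: "g \<in> atom_set v"
  have "\<exists>j \<le> i. psum g j = psum v i" for i
  proof -
    consider "psum v i = 0" | k where "k < i" "k < length v" "v ! k \<noteq> 0" "psum v (Suc k) = psum v i"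
      using psum_support[of i v] by metis
    then show ?thesis
    proof cases
      case 1
      then show ?thesis by (intro exI[of _ 0]) simp
    next
      case 2
      then show ?thesis using g by (intro exI[of _ "Suc k"]) (auto simp: atom_set_def)
    qed
  qed
  then show "g \<in> slide_set v" using g by (simp add: slide_set_def atom_set_def)
qed

lemma self_in_atom_set: "v \<in> atom_set v"
  by (simp add: atom_set_def)

text \<open>When zeros occur only after the full sum is reached, \<open>g\<close> has no freedom: at
  a nonzero entry the next partial sum of \<open>v\<close> exceeds the current common one and must
  be attained exactly one index later. This starts the operator recursion.\<close>

lemma slide_set_packed:
  assumes packed: "\<And>i. i < length v \<Longrightarrow> v ! i = 0 \<Longrightarrow> psum v i = sum_list v"
  shows "slide_set v = {v}"
proof -
  have "g = v" if g: "g \<in> slide_set v" for g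
  proof (rule psum_eqI)
    show len: "length g = length v" using g by (simp add: slide_set_def)
    fix j assume "j \<le> length v"
    then show "psum g j = psum v j"
    proof (induction j)
      case (Suc j)
      then have IH: "psum g j = psum v j" and j: "j < length v" by simp_all
      show ?case
      proof (cases "v ! j = 0")
        case True
        then have "psum v j = sum_list v" using packed j by blast
        moreover have "psum g j \<le> psum g (Suc j)" "psum v j \<le> psum v (Suc j)"
          by (simp_all add: psum_mono)
        moreover have "sum_list g = sum_list v" using g by (simp add: slide_set_def)
        ultimately show ?thesis
          using psum_le[of "Suc j" g] psum_le[of "Suc j" v] IH by linarith
      next
        case False
        obtain k where k: "k \<le> Suc j" "psum g k = psum v (Suc j)"
          using g Suc.prems unfolding slide_set_def by blast
        have "psum g k > psum g j" using k(2) IH False j by (simp add: psum_Suc)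
        then have "k = Suc j" using k(1) psum_mono[of k j g] by (metis le_SucE not_less)
        then show ?thesis using k by simp
      qed
    qed simp
  qed
  moreover have "v \<in> slide_set v" using self_in_atom_set atom_set_subset_slide_set by blast
  ultimately show ?thesis by blast
qed

lemma atom_set_packed:
  assumes "\<And>i. i < length v \<Longrightarrow> v ! i = 0 \<Longrightarrow> psum v i = sum_list v"
  shows "atom_set v = {v}"
  using slide_set_packed[OF assms] atom_set_subset_slide_set self_in_atom_set by blast

section \<open>One generator acting on slide sets and atom sets\<close>

definition adjswap :: "nat \<Rightarrow> nat list \<Rightarrow> nat list" where
  "adjswap i v = v[i := v ! Suc i, Suc i := v ! i]"

lemma length_adjswap [simp]: "length (adjswap i v) = length v"
  by (simp add: adjswap_def)

lemma adjswap_nth: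
  "Suc i < length v \<Longrightarrow>
    adjswap i v ! j = (if j = i then v ! Suc i else if j = Suc i then v ! i else v ! j)"
  by (simp add: adjswap_def nth_list_update)

lemma psum_adjswap:
  "Suc i < length v \<Longrightarrow>
    psum (adjswap i v) j = (if j = Suc i then psum v i + v ! Suc i else psum v j)"
  unfolding adjswap_def by (subst psum_update_two) auto

lemma sum_list_adjswap: "Suc i < length v \<Longrightarrow> sum_list (adjswap i v) = sum_list v"
  unfolding adjswap_def by (intro sum_list_update_two) auto

text \<open>A vector with nonzero right entry arises by \<open>spread\<close> from exactly one
  vector with zero right entry and one \<open>d\<close>. An operator step thereby reduces to two
  closure conditions between index sets.\<close>

lemma sum_spread_reindex:
  assumes "finite E" and "\<And>g. g \<in> E \<Longrightarrow> Suc i < length g \<and> g ! Suc i = 0"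
    and "\<And>g d. g \<in> E \<Longrightarrow> 1 \<le> d \<Longrightarrow> d \<le> g ! i \<Longrightarrow> spread i g d \<in> F"
    and "\<And>h. h \<in> F \<Longrightarrow> Suc i < length h \<and> h ! Suc i \<noteq> 0 \<and> spread i h 0 \<in> E"
  shows "(\<Sum>g\<in>E. qtheta i (monomial_of g)) = mono_sum F"
proof -
  have "(\<Sum>g\<in>E. qtheta i (monomial_of g))
      = (\<Sum>g\<in>E. \<Sum>d\<in>{1..g ! i}. monomial_of (spread i g d))"
    using assms(2) by (intro sum.cong refl qtheta_monomial_left) auto
  also have "\<dots> = (\<Sum>(g, d)\<in>(SIGMA g:E. {1..g ! i}). monomial_of (spread i g d))"
    using assms(1) by (subst sum.Sigma) auto
  also have "\<dots> = mono_sum F"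
  proof (rule sum.reindex_bij_witness[of _ "\<lambda>h. (spread i h 0, h ! Suc i)" "\<lambda>(g, d). spread i g d"])
    fix p assume p: "p \<in> (SIGMA g:E. {1..g ! i})"
    obtain g d where pd: "p = (g, d)" by (cases p)
    then have gd: "g \<in> E" "1 \<le> d" "d \<le> g ! i" using p by auto
    then have g: "Suc i < length g" "g ! Suc i = 0" and d: "d \<le> g ! i + g ! Suc i"
      using assms(2)[of g] by auto
    show "(spread i (case p of (g, d) \<Rightarrow> spread i g d) 0,
        (case p of (g, d) \<Rightarrow> spread i g d) ! Suc i) = p"
      using spread_spread[OF g(1) d, of 0] spread_self[OF g(1)] g
      by (simp add: pd spread_nth)
    show "(case p of (g, d) \<Rightarrow> spread i g d) \<in> F"
      using assms(3)[OF gd] by (simp add: pd)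
  next
    fix h assume "h \<in> F"
    then have h: "Suc i < length h" "h ! Suc i \<noteq> 0" "spread i h 0 \<in> E"
      using assms(4) by auto
    show "(case (spread i h 0, h ! Suc i) of (g, d) \<Rightarrow> spread i g d) = h"
      using spread_spread[OF h(1), of 0 "h ! Suc i"] spread_self[OF h(1)] by simp
    show "(spread i h 0, h ! Suc i) \<in> (SIGMA g:E. {1..g ! i})"
      using h spread_nth[OF h(1), of 0 i] by simp
  qed auto
  finally show ?thesis .
qed

text \<open>A nonzero entry of \<open>v\<close> at \<open>i\<close> keeps \<open>g ! i\<close>
  nonzero, so \<open>qtheta i\<close> kills the monomials with both entries nonzero and spreads the
  others without any sign. The anchored position thereby moves from \<open>i\<close> to
  \<open>Suc i\<close>.\<close>

lemma qtheta_atom_step: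
  assumes i: "Suc i < length v" and v: "v ! i \<noteq> 0" "v ! Suc i = 0"
  shows "qtheta i (mono_sum (atom_set v)) = mono_sum (atom_set (adjswap i v))"
proof -
  define E where "E = {g \<in> atom_set v. g ! Suc i = 0}"
  have len: "length g = length v" if "g \<in> atom_set v" for g
    using that by (simp add: atom_set_def)
  have "qtheta i (mono_sum (atom_set v)) = (\<Sum>g\<in>atom_set v. qtheta i (monomial_of g))"
    by (rule qtheta_sum[OF finite_atom_set])
  also have "\<dots> = (\<Sum>g\<in>E. qtheta i (monomial_of g))"
  proof (rule sum.mono_neutral_right[OF finite_atom_set])
    show "\<forall>g\<in>atom_set v - E. qtheta i (monomial_of g) = 0"
    proof
      fix g assume g: "g \<in> atom_set v - E"
      then have "g ! i \<noteq> 0" "g ! Suc i \<noteq> 0" "Suc i < length g"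
        using i v by (auto simp: E_def atom_set_def)
      then show "qtheta i (monomial_of g) = 0" by (intro qtheta_monomial_both)
    qed
  qed (auto simp: E_def)
  also have "\<dots> = mono_sum (atom_set (adjswap i v))"
  proof (rule sum_spread_reindex)
    show "finite E" using finite_atom_set by (simp add: E_def)
    show "Suc i < length g \<and> g ! Suc i = 0" if "g \<in> E" for g
      using that i len by (auto simp: E_def)
    show "spread i g d \<in> atom_set (adjswap i v)" if g: "g \<in> E" and d: "1 \<le> d" "d \<le> g ! i" for g d
    proof -
      have gi: "Suc i < length g" "d \<le> g ! i + g ! Suc i" and lg: "length g = length v"
        and g0: "g ! Suc i = 0" using g d i len by (auto simp: E_def)
      have S: "psum g (Suc k) = psum v (Suc k)" "g ! k \<noteq> 0" if "k < length v" "v ! k \<noteq> 0" for k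
        using g that by (auto simp: E_def atom_set_def)
      have Si: "psum g (Suc (Suc i)) = psum v (Suc (Suc i))"
        using S(1)[of i] i v g0 lg by (simp add: psum_Suc)
      have "spread i g d ! k \<noteq> 0 \<and> psum (spread i g d) (Suc k) = psum (adjswap i v) (Suc k)"
        if k: "k < length v" "adjswap i v ! k \<noteq> 0" for k
      proof -
        have "k \<noteq> i" using k(2) i v by (auto simp: adjswap_nth)
        then show ?thesis
          using k i v S Si d by (auto simp: adjswap_nth psum_adjswap psum_spread[OF gi] spread_nth[OF gi(1)])
      qed
      then show ?thesis
        using g i lg by (auto simp: atom_set_def sum_list_spread[OF gi] sum_list_adjswap E_def)
    qed
    show "Suc i < length h \<and> h ! Suc i \<noteq> 0 \<and> spread i h 0 \<in> E"
      if h: "h \<in> atom_set (adjswap i v)" for h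
    proof -
      have lh: "length h = length v" and hi: "Suc i < length h" "0 \<le> h ! i + h ! Suc i"
        using h i by (auto simp: atom_set_def)
      have S: "psum h (Suc k) = psum (adjswap i v) (Suc k)" "h ! k \<noteq> 0"
        if "k < length v" "adjswap i v ! k \<noteq> 0" for k
        using h that by (auto simp: atom_set_def)
      have Si: "psum h (Suc (Suc i)) = psum v (Suc (Suc i))" "h ! Suc i \<noteq> 0"
        using S[of "Suc i"] i v by (auto simp: psum_adjswap adjswap_nth)
      have "spread i h 0 ! k \<noteq> 0 \<and> psum (spread i h 0) (Suc k) = psum v (Suc k)"
        if k: "k < length v" "v ! k \<noteq> 0" for k
      proof (cases "k = i")
        case True
        have "psum h (Suc (Suc i)) = psum h i + h ! i + h ! Suc i"
          using hi by (simp add: psum_Suc)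
        moreover have "psum v (Suc (Suc i)) = psum v (Suc i)"
          using i v by (simp add: psum_Suc)
        ultimately show ?thesis
          using True Si by (simp add: psum_spread[OF hi] spread_nth[OF hi(1)])
      next
        case False
        then show ?thesis
          using S[of k] k i v by (auto simp: adjswap_nth psum_adjswap psum_spread[OF hi] spread_nth[OF hi(1)])
      qed
      then have "spread i h 0 \<in> atom_set v"
        using h lh i by (auto simp: atom_set_def sum_list_spread[OF hi] sum_list_adjswap)
      then show ?thesis using hi Si by (simp add: E_def spread_nth)
    qed
  qed
  finally show ?thesis .
qed

text \<open>Moving the zero to the left deletes a single condition, so the slide set grows.
  \<open>qtheta i\<close> has to produce exactly the added monomials, and everything else it
  produces has to cancel.\<close>

lemma qpi_slide_step:
  assumes i: "Suc i < length v" and v: "v ! i \<noteq> 0" "v ! Suc i = 0"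
  shows "qpi i (mono_sum (slide_set v)) = mono_sum (slide_set (adjswap i v))"
proof -
  let ?T = "slide_set v" and ?T' = "slide_set (adjswap i v)"
  \<comment> \<open>The only classes on which \<open>qtheta i\<close> may be nonzero.
    \<open>E2\<close> and \<open>E3\<close> are matched by moving a whole entry between the two
    positions; \<open>E\<close> holds the vectors for which this move leaves the slide set, and
    these generate the new monomials.\<close>
  define E where "E = {g \<in> ?T. g ! Suc i = 0 \<and> spread i g (g ! i) \<notin> ?T}"
  define E2 where "E2 = {g \<in> ?T. g ! i \<noteq> 0 \<and> g ! Suc i = 0 \<and> spread i g (g ! i) \<in> ?T}"
  define E3 where "E3 = {g \<in> ?T. g ! i = 0 \<and> g ! Suc i \<noteq> 0}"
  have len: "length g = length v" if "g \<in> ?T" for g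
    using that by (simp add: slide_set_def)
  have V: "psum v (Suc (Suc i)) = psum v (Suc i)" "psum v (Suc i) = psum v i + v ! i"
    using i v by (simp_all add: psum_Suc)
  \<comment> \<open>At \<open>Suc i\<close> the swapped vector has the partial sum
    \<open>psum v i\<close>, already attained by index \<open>i\<close>; this condition is automatic
    and only the others remain.\<close>
  have T': "g \<in> ?T' \<longleftrightarrow> length g = length v \<and> sum_list g = sum_list v
      \<and> (\<forall>k \<le> length v. k \<noteq> Suc i \<longrightarrow> (\<exists>j \<le> k. psum g j = psum v k))" for g
  proof -
    have "(\<forall>k \<le> length v. \<exists>j \<le> k. psum g j = psum (adjswap i v) k)
      \<longleftrightarrow> (\<forall>k \<le> length v. k \<noteq> Suc i \<longrightarrow> (\<exists>j \<le> k. psum g j = psum v k))" (is "?l \<longleftrightarrow> ?r")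
    proof
      assume l: ?l
      have "\<exists>j \<le> k. psum g j = psum v k" if "k \<le> length v" "k \<noteq> Suc i" for k
        using l[rule_format, of k] that i by (simp add: psum_adjswap)
      then show ?r by blast
    next
      assume r: ?r
      have "\<exists>j \<le> i. psum g j = psum v i" by (rule r[rule_format]) (use i in auto)
      then have wi: "\<exists>j \<le> Suc i. psum g j = psum v i" using le_SucI by blast
      have "\<exists>j \<le> k. psum g j = psum (adjswap i v) k" if "k \<le> length v" for k
      proof (cases "k = Suc i")
        case True
        then show ?thesis using wi i v by (simp add: psum_adjswap)
      next
        case False
        then show ?thesis using r[rule_format, OF that] i by (simp add: psum_adjswap)
      qed
      then show ?l by blast
    qed
    then show ?thesis using i by (simp add: slide_set_def sum_list_adjswap)
  qed
  then have T: "g \<in> ?T \<longleftrightarrow> g \<in> ?T' \<and> (\<exists>j \<le> Suc i. psum g j = psum v (Suc i))" for g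
  proof -
    have split: "(\<forall>k \<le> length v. P k) \<longleftrightarrow> (\<forall>k \<le> length v. k \<noteq> Suc i \<longrightarrow> P k) \<and> P (Suc i)" for P
      proof safe
      show "P (Suc i)" if "\<forall>k \<le> length v. P k" using that i by simp
      show "P k" if "\<forall>k \<le> length v. k \<noteq> Suc i \<longrightarrow> P k" "P (Suc i)" "k \<le> length v" for k
        using that by (cases "k = Suc i") simp_all
    qed simp
    from split[of "\<lambda>k. \<exists>j \<le> k. psum g j = psum v k"] show ?thesis
      unfolding T' unfolding slide_set_def mem_Collect_eq by argo
  qed
  have zero: "qtheta i (monomial_of g) = 0" if "g \<in> ?T" "g \<notin> E" "g \<notin> E2" "g \<notin> E3" for g
  proof -
    have "Suc i < length g" using that(1) len i by simp
    moreover have "g ! i \<noteq> 0 \<and> g ! Suc i \<noteq> 0 \<or> g ! i = 0 \<and> g ! Suc i = 0"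
      using that by (auto simp: E_def E2_def E3_def)
    ultimately show ?thesis
      using qtheta_monomial_both[of i g] qtheta_monomial_left[of i g] by auto
  qed
  have fin: "finite E" "finite E2" "finite E3"
    using finite_slide_set by (simp_all add: E_def E2_def E3_def)
  have "qtheta i (mono_sum ?T) = (\<Sum>g\<in>?T. qtheta i (monomial_of g))"
    by (rule qtheta_sum[OF finite_slide_set])
  also have "\<dots> = (\<Sum>g\<in>E \<union> (E2 \<union> E3). qtheta i (monomial_of g))"
    by (rule sum.mono_neutral_right[OF finite_slide_set])
      (use zero in \<open>auto simp: E_def E2_def E3_def\<close>)
  also have "\<dots> = (\<Sum>g\<in>E. qtheta i (monomial_of g))
      + ((\<Sum>g\<in>E2. qtheta i (monomial_of g)) + (\<Sum>g\<in>E3. qtheta i (monomial_of g)))"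
  proof -
    have "E \<inter> (E2 \<union> E3) = {}"
    proof -
      have False if "g \<in> E" "g \<in> E3" for g using that by (auto simp: E_def E3_def)
      then show ?thesis by (auto simp: E_def E2_def)
    qed
    moreover have "E2 \<inter> E3 = {}" by (auto simp: E2_def E3_def)
    ultimately show ?thesis using fin by (simp add: sum.union_disjoint)
  qed
  also have "(\<Sum>g\<in>E3. qtheta i (monomial_of g)) = (\<Sum>g\<in>E2. - qtheta i (monomial_of g))"
  proof (rule sum.reindex_bij_witness[of _ "\<lambda>g. spread i g (g ! i)" "\<lambda>g. spread i g 0"])
    fix g assume g: "g \<in> E3"
    then have gi: "Suc i < length g" "0 \<le> g ! i + g ! Suc i" and g0: "g ! i = 0" "g ! Suc i \<noteq> 0"
      using len i by (auto simp: E3_def)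
    have gT: "g \<in> ?T" using g by (simp add: E3_def)
    show undo: "spread i (spread i g 0) (spread i g 0 ! i) = g"
      using gi g0 spread_self[OF gi(1)] by (simp add: spread_spread spread_nth)
    have "psum g (Suc i) = psum g i" using gi g0 by (simp add: psum_Suc)
    then have "\<exists>j \<le> k. psum (spread i g 0) j = psum v k" if k: "k \<le> length v" for k
    proof -
      obtain j where j: "j \<le> k" "psum g j = psum v k" using gT k by (auto simp: slide_set_def)
      show ?thesis
      proof (cases "j = Suc i")
        case True
        then show ?thesis using j \<open>psum g (Suc i) = psum g i\<close>
          by (intro exI[of _ i]) (simp add: psum_spread[OF gi])
      next
        case False
        then show ?thesis using j by (intro exI[of _ j]) (simp add: psum_spread[OF gi])
      qed
    qed
    then have "spread i g 0 \<in> ?T"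
      using gT by (simp add: slide_set_def sum_list_spread[OF gi])
    then show "spread i g 0 \<in> E2"
      using undo gT g0 gi by (simp add: E2_def spread_nth)
    show "- qtheta i (monomial_of (spread i g 0)) = qtheta i (monomial_of g)"
      using qtheta_swap_monomial[OF gi(1) g0(1)] by simp
  next
    fix g assume g: "g \<in> E2"
    then have gi: "Suc i < length g" and g0: "g ! i \<noteq> 0" "g ! Suc i = 0"
      using len i by (auto simp: E2_def)
    show "spread i (spread i g (g ! i)) 0 = g"
      using gi g0 spread_self[OF gi(1)] by (simp add: spread_spread)
    show "spread i g (g ! i) \<in> E3"
      using g gi g0 by (simp add: E2_def E3_def spread_nth)
  qed
  also have "(\<Sum>g\<in>E2. qtheta i (monomial_of g)) + (\<Sum>g\<in>E2. - qtheta i (monomial_of g)) = 0"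
    by (simp add: sum_negf)
  also have "(\<Sum>g\<in>E. qtheta i (monomial_of g)) = mono_sum (?T' - ?T)"
  proof (rule sum_spread_reindex)
    show "finite E" by (rule fin)
    show "Suc i < length g \<and> g ! Suc i = 0" if "g \<in> E" for g
      using that i len by (auto simp: E_def)
    show "spread i g d \<in> ?T' - ?T" if g: "g \<in> E" and d: "1 \<le> d" "d \<le> g ! i" for g d
    proof -
      have gT: "g \<in> ?T" using g by (simp add: E_def)
      have gi: "Suc i < length g" and d': "d \<le> g ! i + g ! Suc i"
        and a: "g ! i \<le> g ! i + g ! Suc i" and g0: "g ! Suc i = 0"
        using g d i len by (auto simp: E_def)
      note ps = psum_spread[OF gi d'] psum_spread[OF gi a]
      have P: "psum g (Suc (Suc i)) = psum g (Suc i)" "psum g (Suc i) = psum g i + g ! i"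
        using gi g0 by (simp_all add: psum_Suc)
      have inT': "spread i g e \<in> ?T'" if e: "e \<le> g ! i + g ! Suc i" for e
      proof -
        have "\<exists>j \<le> k. psum (spread i g e) j = psum v k" if k: "k \<le> length v" "k \<noteq> Suc i" for k
        proof -
          obtain j where j: "j \<le> k" "psum g j = psum v k"
            using gT k by (auto simp: slide_set_def)
          show ?thesis
          proof (cases "j = Suc i")
            case True
            then show ?thesis using j k P
              by (intro exI[of _ "Suc (Suc i)"]) (simp add: psum_spread[OF gi e])
          next
            case False
            then show ?thesis using j by (intro exI[of _ j]) (simp add: psum_spread[OF gi e])
          qed
        qed
        moreover have "sum_list g = sum_list v" using gT by (simp add: slide_set_def)
        ultimately show ?thesis using len[OF gT] by (simp add: T' sum_list_spread[OF gi e])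
      qed
      have no: "psum (spread i g (g ! i)) j \<noteq> psum v (Suc i)" if "j \<le> Suc i" for j
        using that g inT'[OF a] T[of "spread i g (g ! i)"] by (auto simp: E_def)
      have "\<exists>j \<le> Suc i. psum g j = psum v (Suc i)" using gT T[of g] by simp
      then obtain j where j: "j \<le> Suc i" "psum g j = psum v (Suc i)" by blast
      \<comment> \<open>An earlier witness would survive moving the entry at \<open>i\<close> to the
        right, although the moved vector lies outside \<open>?T\<close>. So the value is attained at
        \<open>Suc i\<close> only, and any \<open>d \<ge> 1\<close> destroys it.\<close>
      have "j = Suc i" using no[of j] j by (cases "j = Suc i") (simp_all add: ps)
      then have top: "psum g (Suc i) = psum v (Suc i)" using j by simp
      have "psum (spread i g d) j \<noteq> psum v (Suc i)" if "j \<le> Suc i" for j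
      proof -
        have "psum (spread i g d) j \<le> psum (spread i g d) (Suc i)" using that by (rule psum_mono)
        also have "\<dots> < psum g (Suc i)" using d P g0 by (simp add: ps)
        finally show ?thesis using top by simp
      qed
      then show ?thesis using inT'[OF d'] T[of "spread i g d"] by auto
    qed
    show "Suc i < length h \<and> h ! Suc i \<noteq> 0 \<and> spread i h 0 \<in> E" if h: "h \<in> ?T' - ?T" for h
    proof -
      have lh: "length h = length v" and sh: "sum_list h = sum_list v"
        and w: "\<And>k. k \<le> length v \<Longrightarrow> k \<noteq> Suc i \<Longrightarrow> \<exists>j\<le>k. psum h j = psum v k"
        using h T'[of h] by simp_all
      have hi: "Suc i < length h" "0 \<le> h ! i + h ! Suc i" using lh i by simp_all
      have no: "psum h j \<noteq> psum v (Suc i)" if "j \<le> Suc i" for j using h that T[of h] by blast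
      obtain j where j: "j \<le> Suc (Suc i)" "psum h j = psum v (Suc i)"
        using w[of "Suc (Suc i)"] i V by auto
      \<comment> \<open>Since \<open>v ! Suc i = 0\<close>, the condition kept at
        \<open>Suc (Suc i)\<close> asks for the same value as the dropped one. Not attained up to
        \<open>Suc i\<close>, it is attained exactly one index later, and moving everything left
        restores the dropped condition.\<close>
      then have "j = Suc (Suc i)" using no by (metis le_SucE)
      then have top: "psum h (Suc (Suc i)) = psum v (Suc i)" using j by simp
      then have less: "psum h (Suc i) < psum v (Suc i)"
        using no[of "Suc i"] psum_mono[of "Suc i" "Suc (Suc i)" h] by linarith
      then have h1: "h ! Suc i \<noteq> 0" using top hi by (simp add: psum_Suc)
      have Hs: "psum h (Suc (Suc i)) = psum h i + (h ! i + h ! Suc i)"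
        using hi by (simp add: psum_Suc)
      note ps = psum_spread[OF hi]
      have "\<exists>j\<le>k. psum (spread i h 0) j = psum v k" if k: "k \<le> length v" for k
      proof (cases "k = Suc i")
        case True
        then show ?thesis using top Hs by (intro exI[of _ "Suc i"]) (simp add: ps)
      next
        case False
        then obtain j where j: "j \<le> k" "psum h j = psum v k" using w k by blast
        have "j \<noteq> Suc i"
        proof
          assume "j = Suc i"
          then have "psum v (Suc i) \<le> psum v k" using j by (intro psum_mono) simp
          then show False using less j \<open>j = Suc i\<close> by simp
        qed
        then show ?thesis using j by (intro exI[of _ j]) (simp add: ps)
      qed
      then have inT: "spread i h 0 \<in> ?T"
        using lh sh by (simp add: slide_set_def sum_list_spread[OF hi])
      let ?s = "spread i h (h ! i + h ! Suc i)"
      have "psum ?s j \<noteq> psum v (Suc i)" if "j \<le> Suc i" for j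
      proof -
        have "psum ?s j \<le> psum ?s (Suc i)" using that by (rule psum_mono)
        also have "\<dots> \<le> psum h (Suc i)"
          using psum_mono[of i "Suc i" h] by (simp add: psum_spread[OF hi(1)])
        finally show ?thesis using less by simp
      qed
      then have "?s \<notin> ?T" using T[of ?s] by blast
      then have "spread i h 0 \<in> E"
        using inT hi by (simp add: E_def spread_nth spread_spread)
      then show ?thesis using hi h1 by simp
    qed
  qed
  finally have "qtheta i (mono_sum ?T) = mono_sum (?T' - ?T)" by simp
  moreover have "mono_sum ?T' = mono_sum (?T' - ?T) + mono_sum ?T"
    using T by (intro sum.subset_diff finite_slide_set) blast
  ultimately show ?thesis by (simp add: qtheta_def algebra_simps)
qed

subsection \<open>Reduced words of sorting permutations\<close>

text \<open>Up to a constant depending on the number of nonzero entries, this counts the pairs of a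
  zero preceding a nonzero entry, the inversions that sorting has to remove.\<close>

definition rho :: "nat list \<Rightarrow> nat" where
  "rho v = (\<Sum>k<length v. if v ! k = 0 then 0 else k)"

lemma rho_adjswap:
  assumes "Suc i < length v"
  shows "rho (adjswap i v) + (if v ! i = 0 then 0 else i) + (if v ! Suc i = 0 then 0 else Suc i)
    = rho v + (if v ! Suc i = 0 then 0 else i) + (if v ! i = 0 then 0 else Suc i)"
proof -
  have split: "(\<Sum>k<length v. f k) = (\<Sum>k\<in>{..<length v} - {i, Suc i}. f k) + (f i + f (Suc i))"
    for f :: "nat \<Rightarrow> nat"
    using assms by (subst sum.subset_diff[of "{i, Suc i}"]) auto
  have "(\<Sum>k\<in>{..<length v} - {i, Suc i}. if adjswap i v ! k = 0 then 0 else k)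
      = (\<Sum>k\<in>{..<length v} - {i, Suc i}. if v ! k = 0 then 0 else k)"
    using assms by (intro sum.cong refl) (auto simp: adjswap_nth)
  then show ?thesis
    using assms unfolding rho_def length_adjswap split by (simp add: adjswap_nth)
qed

lemma rho_adjswap_le: "Suc i < length v \<Longrightarrow> rho (adjswap i v) \<le> Suc (rho v)"
  using rho_adjswap[of i v] by (simp split: if_splits)

text \<open>Maximal growth forces the shape assumed in \<open>qtheta_atom_step\<close> and
  \<open>qpi_slide_step\<close>.\<close>

lemma rho_adjswap_eq:
  "Suc i < length v \<Longrightarrow> rho (adjswap i v) = Suc (rho v) \<Longrightarrow> v ! i \<noteq> 0 \<and> v ! Suc i = 0"
  using rho_adjswap[of i v] by (auto split: if_splits)

lemma length_foldr_adjswap [simp]: "length (foldr adjswap js v) = length v"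
  by (induction js) simp_all

lemma adjswap_adjswap: "Suc i < length v \<Longrightarrow> adjswap i (adjswap i v) = v"
  by (rule nth_equalityI) (simp_all add: adjswap_nth)

lemma foldr_adjswap_rev:
  "\<forall>i\<in>set js. Suc i < length v \<Longrightarrow> foldr adjswap (rev js) (foldr adjswap js v) = v"
  by (induction js) (simp_all add: adjswap_adjswap)

lemma permute_list_transpose:
  "Suc i < length v \<Longrightarrow> permute_list (transpose i (Suc i)) v = adjswap i v"
  by (rule nth_equalityI) (auto simp: permute_list_def adjswap_nth transpose_def)

lemma word_perm_Cons: "word_perm (i # js) = transpose i (Suc i) \<circ> word_perm js"
  by (simp add: word_perm_def)

lemma bij_word_perm: "bij (word_perm js)"
proof (induction js)
  case (Cons i js)
  then have "bij (transpose i (Suc i) \<circ> word_perm js)" by (intro bij_comp) simp_all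
  then show ?case by (simp only: word_perm_Cons)
qed (simp add: word_perm_def bij_id[unfolded id_def] id_def)

lemma word_perm_append: "word_perm (is @ js) = word_perm is \<circ> word_perm js"
  by (induction "is") (simp_all add: word_perm_def o_assoc)

lemma word_perm_rev: "word_perm (rev js) = inv (word_perm js)"
proof (induction js)
  case (Cons i js)
  have "inv (word_perm (i # js)) = inv (word_perm js) \<circ> transpose i (Suc i)"
    by (simp add: word_perm_Cons o_inv_distrib bij_word_perm)
  moreover have "word_perm [i] = transpose i (Suc i)" by (simp add: word_perm_def)
  ultimately show ?case using Cons by (simp add: word_perm_append)
qed (simp add: word_perm_def)

text \<open>The inverse in \<open>act\<close> turns the composition-reversing
  \<open>permute_list\<close> into a left action, so the letters of a word act in the order in which
  \<open>foldr\<close> applies the operators.\<close>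

lemma act_word_perm:
  "\<forall>i\<in>set js. Suc i < length v \<Longrightarrow> act (word_perm js) v = foldr adjswap js v"
proof (induction js)
  case Nil
  show ?case by (simp add: act_def word_perm_def)
next
  case (Cons i js)
  then have i: "Suc i < length v" by simp
  then have "transpose i (Suc i) permutes {..<length v}"
    by (intro permutes_swap_id) auto
  then have "act (word_perm (i # js)) v
      = permute_list (transpose i (Suc i)) (permute_list (inv (word_perm js)) v)"
    by (simp add: act_def word_perm_Cons o_inv_distrib bij_word_perm permute_list_compose)
  also have "\<dots> = adjswap i (act (word_perm js) v)"
    using i by (simp add: permute_list_transpose act_def)
  finally show ?case using Cons by simp
qed

lemma word_for_rev: "word_for n w js \<Longrightarrow> word_for n (inv w) (rev js)"
  by (auto simp: word_for_def word_perm_rev)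

lemma word_for_append: "word_for n w is \<Longrightarrow> word_for n w' js \<Longrightarrow> word_for n (w \<circ> w') (is @ js)"
  by (auto simp: word_for_def word_perm_append)

lemma ex_word_for_transpose:
  assumes "a < b" and "b < n"
  shows "\<exists>js. word_for n (transpose a b) js"
  using assms
proof (induction b)
  case (Suc b)
  have s: "word_for n (transpose b (Suc b)) [b]"
    using Suc.prems by (simp add: word_for_def word_perm_def)
  show ?case
  proof (cases "a = b")
    case True
    then show ?thesis using s by blast
  next
    case False
    then obtain js where "word_for n (transpose a b) js" using Suc by auto
    then have "word_for n (transpose b (Suc b) \<circ> transpose a b \<circ> transpose b (Suc b)) ([b] @ js @ [b])"
      using s by (metis word_for_append o_assoc)
    moreover have "transpose b (Suc b) \<circ> transpose a b \<circ> transpose b (Suc b) = transpose a (Suc b)"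
      using False Suc.prems by (auto simp: fun_eq_iff transpose_def)
    ultimately show ?thesis by auto
  qed
qed simp

lemma ex_word_for:
  assumes "w permutes {..<n}"
  shows "\<exists>js. word_for n w js"
  using assms finite_lessThan
proof (induction rule: permutes_induct)
  case id
  have "word_for n id []" by (simp add: word_for_def word_perm_def)
  then show ?case by blast
next
  case (swap a b p)
  then have "\<exists>js. word_for n (transpose a b) js"
    using ex_word_for_transpose[of a b n] ex_word_for_transpose[of b a n]
    by (cases "a < b") (auto simp: transpose_commute)
  then show ?case using swap word_for_append by blast
qed

lemma flat_eq_self:
  assumes "\<And>i. Suc i < length v \<Longrightarrow> v ! i = 0 \<Longrightarrow> v ! Suc i = 0"
  shows "flat v = v"
  using assms
proof (induction v)
  case (Cons a v)
  have IH: "flat v = v"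
    using Cons.prems[of "Suc _"] by (intro Cons.IH) auto
  show ?case
  proof (cases "a = 0")
    case False
    then show ?thesis using IH by (simp add: flat_def strong_def)
  next
    case True
    have "k < length (a # v) \<Longrightarrow> (a # v) ! k = 0" for k
      using True Cons.prems by (induction k) auto
    then have "\<forall>x\<in>set (a # v). x = 0" by (metis in_set_conv_nth)
    then have "strong (a # v) = []" "filter (\<lambda>x. x = 0) (a # v) = a # v"
      by (auto simp: strong_def filter_id_conv)
    then show ?thesis by (simp only: flat_def) simp
  qed
qed (simp add: flat_def strong_def)

lemma flat_adjswap:
  assumes "Suc i < length v" and "v ! i = 0"
  shows "flat (adjswap i v) = flat v"
proof -
  have v: "v = take i v @ [0, v ! Suc i] @ drop (Suc (Suc i)) v"
    using update_two_conv[OF assms(1), of "v ! i" "v ! Suc i"] assms(2)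
    by (metis list_update_id)
  have s: "adjswap i v = take i v @ [v ! Suc i, 0] @ drop (Suc (Suc i)) v"
    using update_two_conv[OF assms(1), of "v ! Suc i" "v ! i"] assms(2) by (simp add: adjswap_def)
  have "flat (xs @ [b, 0] @ ys) = flat (xs @ [0, b] @ ys)" for xs ys and b :: nat
    by (simp add: flat_def strong_def)
  then show ?thesis using v s by metis
qed

lemma length_flat [simp]: "length (flat v) = length v"
  using sum_length_filter_compl[of "\<lambda>a. a \<noteq> 0" v] by (simp add: flat_def strong_def)

text \<open>Bubble sorting: while \<open>v\<close> is not flat, some zero stands directly before a
  nonzero entry, and exchanging them lowers \<open>rho\<close> by one. The resulting word meets the
  length bound of \<open>foldr_operators\<close> with equality.\<close>

lemma ex_sorting_word:
  "\<exists>js. (\<forall>i\<in>set js. Suc i < length v) \<and> foldr adjswap js (flat v) = v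
    \<and> rho v = rho (flat v) + length js"
proof (induction "rho v" arbitrary: v rule: less_induct)
  case less
  show ?case
  proof (cases "flat v = v")
    case True
    then show ?thesis by (intro exI[of _ "[]"]) simp
  next
    case False
    then obtain i where i: "Suc i < length v" "v ! i = 0" "v ! Suc i \<noteq> 0"
      using flat_eq_self by blast
    have r: "rho v = Suc (rho (adjswap i v))" using rho_adjswap[of i v] i by simp
    then obtain js where js: "\<forall>k\<in>set js. Suc k < length v"
        "foldr adjswap js (flat (adjswap i v)) = adjswap i v"
        "rho (adjswap i v) = rho (flat (adjswap i v)) + length js"
      using less[of "adjswap i v"] by auto
    then show ?thesis
      using i r by (intro exI[of _ "i # js"]) (simp add: flat_adjswap adjswap_adjswap)
  qed
qed

text \<open>Each letter adds at most one to \<open>rho\<close>. If the total growth equals the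
  number of letters, no letter has slack, so the one-step lemmas apply at every letter, from the
  right end of the word.\<close>

lemma foldr_operators:
  assumes "\<forall>i\<in>set js. Suc i < length v"
  shows "rho (foldr adjswap js v) \<le> rho v + length js"
    and "rho (foldr adjswap js v) = rho v + length js \<Longrightarrow>
      foldr qtheta js (mono_sum (atom_set v)) = mono_sum (atom_set (foldr adjswap js v)) \<and>
      foldr qpi js (mono_sum (slide_set v)) = mono_sum (slide_set (foldr adjswap js v))"
proof -
  have "rho (foldr adjswap js v) \<le> rho v + length js \<and>
    (rho (foldr adjswap js v) = rho v + length js \<longrightarrow>
      foldr qtheta js (mono_sum (atom_set v)) = mono_sum (atom_set (foldr adjswap js v)) \<and>
      foldr qpi js (mono_sum (slide_set v)) = mono_sum (slide_set (foldr adjswap js v)))"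
    using assms
  proof (induction js)
    case (Cons i js)
    let ?u = "foldr adjswap js v"
    have i: "Suc i < length ?u" using Cons.prems by simp
    have IH: "rho ?u \<le> rho v + length js" "rho ?u = rho v + length js \<Longrightarrow>
      foldr qtheta js (mono_sum (atom_set v)) = mono_sum (atom_set ?u) \<and>
      foldr qpi js (mono_sum (slide_set v)) = mono_sum (slide_set ?u)"
      using Cons by auto
    have le: "rho (adjswap i ?u) \<le> Suc (rho ?u)" using rho_adjswap_le[OF i] .
    show ?case
    proof (intro conjI impI)
      show "rho (foldr adjswap (i # js) v) \<le> rho v + length (i # js)" using IH(1) le by simp
      assume "rho (foldr adjswap (i # js) v) = rho v + length (i # js)"
      then have eq: "rho ?u = rho v + length js" "rho (adjswap i ?u) = Suc (rho ?u)"
        using IH(1) le by simp_all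
      note nz = rho_adjswap_eq[OF i eq(2)]
      show "foldr qtheta (i # js) (mono_sum (atom_set v))
          = mono_sum (atom_set (foldr adjswap (i # js) v))"
        using IH(2)[OF eq(1)] qtheta_atom_step[OF i] nz by simp
      show "foldr qpi (i # js) (mono_sum (slide_set v))
          = mono_sum (slide_set (foldr adjswap (i # js) v))"
        using IH(2)[OF eq(1)] qpi_slide_step[OF i] nz by simp
    qed
  qed simp
  then show "rho (foldr adjswap js v) \<le> rho v + length js"
    and "rho (foldr adjswap js v) = rho v + length js \<Longrightarrow>
      foldr qtheta js (mono_sum (atom_set v)) = mono_sum (atom_set (foldr adjswap js v)) \<and>
      foldr qpi js (mono_sum (slide_set v)) = mono_sum (slide_set (foldr adjswap js v))"
    by blast+
qed

lemma flat_packed: "i < length (flat v) \<Longrightarrow> flat v ! i = 0 \<Longrightarrow> psum (flat v) i = sum_list (flat v)"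
proof -
  assume i: "i < length (flat v)" "flat v ! i = 0"
  have z: "sum_list (filter (\<lambda>a. a = 0) v) = 0" by simp
  then have z': "psum (filter (\<lambda>a. a = 0) v) k = 0" for k
    using psum_le[of k "filter (\<lambda>a. a = 0) v"] by (simp only: z le_zero_eq)
  have "\<not> i < length (strong v)"
  proof
    assume s: "i < length (strong v)"
    then have "strong v ! i \<in> set (strong v)" by simp
    then show False using i(2) s by (simp add: flat_def nth_append strong_def)
  qed
  then have "take i (flat v) = strong v @ take (i - length (strong v)) (filter (\<lambda>a. a = 0) v)"
    by (simp add: flat_def)
  then show ?thesis by (simp only: flat_def sum_list_append z z')
qed

text \<open>The weighted position sum \<^const>\<open>rho\<close> grows by at most one with each generator, so along a word
  of minimal length every letter exchanges a nonzero entry with a zero on its right. This replaces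
  any appeal to braid relations or to uniqueness of the sorting permutation.\<close>

lemma reduced_word_sorting:
  fixes v :: "nat list"
  defines "js \<equiv> (SOME is. reduced_word (length v) (inv (sorting_perm v)) is)"
  shows "\<forall>i\<in>set js. Suc i < length v" and "foldr adjswap js (flat v) = v"
    and "rho v = rho (flat v) + length js"
proof -
  let ?n = "length v" and ?P = "\<lambda>w. w permutes {..<length v} \<and> act w v = flat v"
  obtain ks where ks: "\<forall>i\<in>set ks. Suc i < ?n" "foldr adjswap ks (flat v) = v"
      "rho v = rho (flat v) + length ks"
    using ex_sorting_word by blast
  let ?u = "word_perm (rev ks)"
  have perm: "word_perm is permutes {..<?n}" if "\<forall>i\<in>set is. Suc i < ?n" for "is"
    using that
  proof (induction "is")
    case (Cons i "is")
    then have "transpose i (Suc i) permutes {..<?n}" by (intro permutes_swap_id) auto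
    moreover have "word_perm is permutes {..<?n}" using Cons by simp
    ultimately show ?case unfolding word_perm_Cons by (rule permutes_compose[rotated])
  qed (simp add: word_perm_def permutes_id)
  have "act ?u v = flat v"
    using ks foldr_adjswap_rev[of ks "flat v"] act_word_perm[of "rev ks" v] by simp
  then have P0: "?P ?u" using perm[of "rev ks"] ks(1) by simp
  have w0: "perm_length ?n ?u \<le> length ks"
    unfolding perm_length_def
    by (rule Least_le, rule exI[of _ "rev ks"]) (use ks(1) in \<open>simp add: word_for_def\<close>)
  let ?w = "sorting_perm v"
  have w: "?P ?w" and wle: "perm_length ?n ?w \<le> perm_length ?n ?u"
    unfolding sorting_perm_def
    by (rule arg_min_natI[of ?P, OF P0], rule arg_min_nat_le[of ?P, OF P0])
  obtain ls where ls: "word_for ?n ?w ls" "length ls = perm_length ?n ?w"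
  proof -
    have "\<exists>k is. word_for ?n ?w is \<and> length is = k" using ex_word_for w by blast
    then have "\<exists>is. word_for ?n ?w is \<and> length is = perm_length ?n ?w"
      unfolding perm_length_def by (rule LeastI_ex)
    then show ?thesis using that by blast
  qed
  have "word_for ?n (inv ?w) (rev ls)" using ls word_for_rev by blast
  then have "is_arg_min length (word_for ?n (inv ?w)) (arg_min length (word_for ?n (inv ?w)))"
    by (rule is_arg_min_arg_min_nat)
  then have "reduced_word ?n (inv ?w) js"
    unfolding js_def reduced_word_def by (rule someI)
  then have js: "word_for ?n (inv ?w) js" and min: "length js \<le> length (rev ls)"
    using \<open>word_for ?n (inv ?w) (rev ls)\<close> by (auto simp: reduced_word_def is_arg_min_linorder)
  show 1: "\<forall>i\<in>set js. Suc i < ?n" using js by (simp add: word_for_def)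
  have lsr: "\<forall>i\<in>set ls. Suc i < ?n" "word_perm ls = ?w" using ls by (simp_all add: word_for_def)
  have "flat v = foldr adjswap ls v" using w act_word_perm[OF lsr(1)] lsr(2) by simp
  moreover have "act (inv ?w) (foldr adjswap ls v) = foldr adjswap (rev ls) (foldr adjswap ls v)"
    using act_word_perm[of "rev ls" "foldr adjswap ls v"] lsr by (simp add: word_perm_rev)
  ultimately have "act (inv ?w) (flat v) = v" using foldr_adjswap_rev[OF lsr(1)] by simp
  moreover have "act (inv ?w) (flat v) = foldr adjswap js (flat v)"
    using act_word_perm[of js "flat v"] js 1 by (simp add: word_for_def)
  ultimately show 2: "foldr adjswap js (flat v) = v" by simp
  have "rho v \<le> rho (flat v) + length js"
    using foldr_operators(1)[of js "flat v"] 1 2 by simp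
  \<comment> \<open>The reverse bound is a chain: \<open>js\<close> is no longer than the minimal
    word \<open>ls\<close> of the sorting permutation, and minimality of that permutation bounds
    \<open>ls\<close> by the explicit word \<open>ks\<close>.\<close>
  then show "rho v = rho (flat v) + length js"
    using min[unfolded length_rev] ls(2) wle w0 ks(3) by linarith
qed

theorem fundamental_slide_expansion: "fundamental_slide v = mono_sum (slide_set v)"
  and fundamental_atom_expansion: "fundamental_atom v = mono_sum (atom_set v)"
proof -
  have "slide_set (flat v) = {flat v}" "atom_set (flat v) = {flat v}"
    using slide_set_packed atom_set_packed flat_packed by blast+
  then show "fundamental_slide v = mono_sum (slide_set v)"
    "fundamental_atom v = mono_sum (atom_set v)"
    using foldr_operators(2)[of _ "flat v"] reduced_word_sorting[of v]
    by (simp_all add: fundamental_slide_def fundamental_atom_def qpi_perm_def qtheta_perm_def)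
qed

subsection \<open>Position lists\<close>

text \<open>Recording the position of each unit turns conditions on partial sums into comparisons of
  lists, index by index.\<close>

definition positions :: "nat list \<Rightarrow> nat list" where
  "positions v = concat (map (\<lambda>i. replicate (v ! i) i) [0..<length v])"

lemma positions_Nil [simp]: "positions [] = []"
  by (simp add: positions_def)

lemma positions_snoc [simp]: "positions (v @ [a]) = positions v @ replicate a (length v)"
proof -
  have "map (\<lambda>i. replicate ((v @ [a]) ! i) i) [0..<length v]
      = map (\<lambda>i. replicate (v ! i) i) [0..<length v]"
    by (simp add: nth_append)
  from arg_cong[OF this, of concat] show ?thesis by (simp add: positions_def)
qed

lemma length_positions [simp]: "length (positions v) = sum_list v"
  by (induction v rule: rev_induct) simp_all

lemma set_positions: "set (positions v) \<subseteq> {..<length v}"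
  by (auto simp: positions_def)

lemma positions_nth_less: "k < sum_list v \<Longrightarrow> positions v ! k < length v"
  using subsetD[OF set_positions nth_mem, of k v] by simp

lemma sorted_positions: "sorted (positions v)"
proof (induction v rule: rev_induct)
  case (snoc a v)
  then show ?case using set_positions[of v] by (auto simp: sorted_append less_imp_le)
qed simp

text \<open>The adjunction between partial sums and position lists; all translations of partial-sum
  conditions rest on it.\<close>

lemma positions_less_iff:
  "k < sum_list v \<Longrightarrow> j \<le> length v \<Longrightarrow> positions v ! k < j \<longleftrightarrow> k < psum v j"
proof (induction v rule: rev_induct)
  case (snoc a v)
  show ?case
  proof (cases "k < sum_list v")
    case True
    then show ?thesis
      using snoc positions_nth_less[OF True] by (cases "j \<le> length v") (auto simp: nth_append le_Suc_eq)
  next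
    case False
    then show ?thesis
      using snoc.prems psum_le[of j v] by (cases "j \<le> length v") (auto simp: nth_append le_Suc_eq)
  qed
qed simp

lemma count_positions: "count (mset (positions v)) i = (if i < length v then v ! i else 0)"
  by (induction v rule: rev_induct) (auto simp: nth_append not_less)

lemma positions_inject:
  assumes "length v = length w" and "positions v = positions w"
  shows "v = w"
proof (rule nth_equalityI[OF assms(1)])
  fix i assume "i < length v"
  then show "v ! i = w ! i" using assms count_positions[of v i] count_positions[of w i] by simp
qed

definition counts :: "nat \<Rightarrow> nat list \<Rightarrow> nat list" where
  "counts n c = map (count (mset c)) [0..<n]"

lemma length_counts [simp]: "length (counts n c) = n"
  by (simp add: counts_def)

lemma positions_counts:
  assumes "sorted c" and "set c \<subseteq> {..<n}"
  shows "positions (counts n c) = c"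
proof -
  have "mset (positions (counts n c)) = mset c"
  proof (rule multiset_eqI)
    fix i
    show "count (mset (positions (counts n c))) i = count (mset c) i"
      using assms(2) by (auto simp: count_positions counts_def count_eq_zero_iff simp flip: not_in_iff)
  qed
  then have "sort c = positions (counts n c)"
    using properties_for_sort sorted_positions by blast
  then show ?thesis using assms(1) by (simp add: sorted_sort_id)
qed

lemma counts_positions: "counts (length v) (positions v) = v"
  by (rule nth_equalityI) (simp_all add: counts_def count_positions)

lemma sum_list_counts:
  assumes "sorted c" and "set c \<subseteq> {..<n}"
  shows "sum_list (counts n c) = length c"
  using length_positions[of "counts n c"] positions_counts[OF assms] by simp

lemma monomial_of_positions: "monomial_of v = prod_list (map var (positions v))"
proof (induction v rule: rev_induct)
  case Nil
  show ?case by (simp add: monomial_of_def)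
next
  case (snoc a v)
  have "Poly_Mapping.nth (v @ [a]) = Poly_Mapping.nth v + Poly_Mapping.single (length v) a"
    by (rule poly_mapping_eqI)
      (auto simp: lookup_add lookup_single nth_default_def nth_append when_def)
  then have "monomial_of (v @ [a]) = monomial_of v * var (length v) ^ a"
    by (simp add: monomial_of_def var_power frag_of_mult)
  then show ?case using snoc by (simp add: prod_list_replicate)
qed

text \<open>That \<open>g\<close> attains the partial sum \<open>Suc k\<close> means that some index
  separates unit \<open>k\<close> from unit \<open>Suc k\<close> in its position list; the first
  condition ensures that this happens early enough.\<close>

lemma slide_set_iff:
  assumes "length g = length v" and "sum_list g = sum_list v"
  shows "g \<in> slide_set v \<longleftrightarrow> (\<forall>k < sum_list v. positions g ! k \<le> positions v ! k) \<and>
    (\<forall>k. Suc k < sum_list v \<longrightarrow> positions v ! k < positions v ! Suc k \<longrightarrow>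
      positions g ! k < positions g ! Suc k)"
    (is "_ \<longleftrightarrow> ?A \<and> ?B")
proof
  assume g: "g \<in> slide_set v"
  have 1: ?A
  proof (intro allI impI)
    fix k assume k: "k < sum_list v"
    let ?i = "Suc (positions v ! k)"
    have i: "?i \<le> length v" using positions_nth_less[OF k] by simp
    then obtain j where j: "j \<le> ?i" "psum g j = psum v ?i"
      using g by (auto simp: slide_set_def)
    have "k < psum g j" using positions_less_iff[OF k i] j(2) by simp
    then have "positions g ! k < j"
      using positions_less_iff[of k g j] k i j(1) assms by simp
    then show "positions g ! k \<le> positions v ! k" using j by simp
  qed
  have 2: ?B
  proof (intro allI impI)
    fix k assume k: "Suc k < sum_list v" and less: "positions v ! k < positions v ! Suc k"
    let ?i = "Suc (positions v ! k)"
    have i: "?i \<le> length v" using positions_nth_less[of k v] k by simp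
    then obtain j where j: "j \<le> ?i" "psum g j = psum v ?i"
      using g by (auto simp: slide_set_def)
    have "k < psum v ?i" "\<not> Suc k < psum v ?i"
      using positions_less_iff[of k v ?i] positions_less_iff[of "Suc k" v ?i] k i less by simp_all
    then have "positions g ! k < j" "\<not> positions g ! Suc k < j"
      using positions_less_iff[of k g j] positions_less_iff[of "Suc k" g j] k i j assms by simp_all
    then show "positions g ! k < positions g ! Suc k" by simp
  qed
  show "?A \<and> ?B" using 1 2 ..
next
  assume AB: "?A \<and> ?B"
  have "\<exists>j \<le> i. psum g j = psum v i" if i: "i \<le> length v" for i
  proof (cases "psum v i")
    case 0
    then show ?thesis by (intro exI[of _ 0]) simp
  next
    case (Suc k)
    then have k: "k < sum_list v" using psum_le[of i v] by simp
    then have vi: "positions v ! k < i" using positions_less_iff[OF k i] Suc by simp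
    \<comment> \<open>The earliest index that counts unit \<open>k\<close>; it attains the value
      \<open>Suc k\<close> unless unit \<open>Suc k\<close> sits at the same position.\<close>
    let ?j = "Suc (positions g ! k)"
    have ji: "?j \<le> i" using AB k vi by (meson Suc_leI le_less_trans)
    have k_less: "k < psum g ?j"
      using positions_less_iff[of k g ?j] k ji i assms by simp
    have "\<not> Suc k < psum g ?j"
    proof
      assume less: "Suc k < psum g ?j"
      then have k': "Suc k < sum_list v" using psum_le[of ?j g] assms by simp
      then have "\<not> positions v ! Suc k < i" using positions_less_iff[OF k' i] Suc by simp
      then have "positions g ! k < positions g ! Suc k" using AB k' vi by simp
      then show False using positions_less_iff[of "Suc k" g ?j] less k' ji i assms by simp
    qed
    then show ?thesis using k_less ji Suc by (intro exI[of _ ?j]) simp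
  qed
  then show "g \<in> slide_set v" using assms by (simp add: slide_set_def)
qed

text \<open>The extra condition gives each part of \<open>v\<close> a unit left in place by
  \<open>g\<close>. With the slide conditions this also pins the partial sum: the last unit of the
  part is squeezed onto the same position, and the unit after it lies strictly later.\<close>

lemma atom_set_iff:
  assumes "length g = length v" and "sum_list g = sum_list v"
  shows "g \<in> atom_set v \<longleftrightarrow> g \<in> slide_set v \<and>
    (\<forall>k < sum_list v. \<exists>m < sum_list v. positions v ! m = positions v ! k \<and>
      positions g ! m = positions v ! k)"
    (is "_ \<longleftrightarrow> _ \<and> ?C")
proof
  assume g: "g \<in> atom_set v"
  have ?C
  proof (intro allI impI)
    fix k assume k: "k < sum_list v"
    let ?i = "positions v ! k"
    have i: "?i < length v" using positions_nth_less[OF k] .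
    have "k < psum v (Suc ?i)" "\<not> k < psum v ?i"
      using positions_less_iff[OF k, of "Suc ?i"] positions_less_iff[OF k, of ?i] i by simp_all
    then have vi: "v ! ?i \<noteq> 0" using i by (auto simp: psum_Suc)
    then have gi: "g ! ?i \<noteq> 0" "psum g (Suc ?i) = psum v (Suc ?i)"
      using g i by (auto simp: atom_set_def)
    \<comment> \<open>The last unit of the part: as the partial sums behind it agree and
      \<open>g ! ?i\<close> is nonzero, it is also the last unit of \<open>g\<close> at
      \<open>?i\<close>.\<close>
    define m where "m = psum v (Suc ?i) - 1"
    have m: "m < psum v (Suc ?i)" "\<not> m < psum v ?i" "\<not> m < psum g ?i"
      using vi gi i assms unfolding m_def by (simp_all add: psum_Suc)
    then have mN: "m < sum_list v" using psum_le[of "Suc ?i" v] by simp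
    have "positions v ! m = ?i"
      using positions_less_iff[OF mN, of "Suc ?i"] positions_less_iff[OF mN, of ?i] m i by simp
    moreover have "positions g ! m = ?i"
      using positions_less_iff[of m g "Suc ?i"] positions_less_iff[of m g ?i] m i mN gi(2) assms
      by simp
    ultimately show "\<exists>m < sum_list v. positions v ! m = ?i \<and> positions g ! m = ?i"
      using mN by blast
  qed
  then show "g \<in> slide_set v \<and> ?C" using g atom_set_subset_slide_set by blast
next
  assume gC: "g \<in> slide_set v \<and> ?C"
  then have A: "\<And>k. k < sum_list v \<Longrightarrow> positions g ! k \<le> positions v ! k"
    and B: "\<And>k. Suc k < sum_list v \<Longrightarrow> positions v ! k < positions v ! Suc k \<Longrightarrow>
      positions g ! k < positions g ! Suc k"
    using slide_set_iff[OF assms] by blast+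
  have "g ! i \<noteq> 0 \<and> psum g (Suc i) = psum v (Suc i)" if i: "i < length v" "v ! i \<noteq> 0" for i
  proof -
    define k where "k = psum v (Suc i) - 1"
    have k: "k < psum v (Suc i)" "\<not> k < psum v i" "psum v (Suc i) = Suc k"
      using i unfolding k_def by (simp_all add: psum_Suc)
    then have kN: "k < sum_list v" using psum_le[of "Suc i" v] by simp
    have vk: "positions v ! k = i"
      using positions_less_iff[OF kN, of "Suc i"] positions_less_iff[OF kN, of i] k i by simp
    obtain m where m: "m < sum_list v" "positions v ! m = i" "positions g ! m = i"
      using gC kN vk by blast
    have "m < psum g (Suc i)" "\<not> m < psum g i"
      using positions_less_iff[of m g "Suc i"] positions_less_iff[of m g i] m i assms by simp_all
    then have gi: "g ! i \<noteq> 0" using i assms by (auto simp: psum_Suc)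
    have "m < psum v (Suc i)" using positions_less_iff[OF m(1), of "Suc i"] m i by simp
    then have "m \<le> k" using k by simp
    then have "i \<le> positions g ! k"
      using sorted_positions[of g] kN m assms by (metis length_positions sorted_nth_mono)
    then have gk: "positions g ! k = i" using A[OF kN] vk by simp
    then have "k < psum g (Suc i)" using positions_less_iff[of k g "Suc i"] kN i assms by simp
    moreover have "\<not> Suc k < psum g (Suc i)"
    proof
      assume less: "Suc k < psum g (Suc i)"
      then have k': "Suc k < sum_list v" using psum_le[of "Suc i" g] assms by simp
      have "\<not> positions v ! Suc k < Suc i" using positions_less_iff[OF k', of "Suc i"] i k by simp
      then have "i < positions g ! Suc k" using B[OF k'] vk gk by simp
      then show False
        using positions_less_iff[of "Suc k" g "Suc i"] less k' i assms by simp
    qed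
    ultimately show ?thesis using gi k(3) by simp
  qed
  then show "g \<in> atom_set v" using assms by (simp add: atom_set_def)
qed

text \<open>Below, \<open>f\<close> maps the part index of a letter to the letter itself and \<open>h\<close> recovers the index.
  Sorting is lexicographic, first by position.\<close>

lemma sorted_zip_positions_iff:
  assumes sums: "sum_list g = sum_list v"
    and f: "\<And>p q. p < q \<Longrightarrow> q < length v \<Longrightarrow> (f q :: nat) < f p"
  shows "sorted (zip (positions g) (map f (positions v))) \<longleftrightarrow>
    (\<forall>k. Suc k < sum_list v \<longrightarrow> positions v ! k < positions v ! Suc k \<longrightarrow>
      positions g ! k < positions g ! Suc k)"
proof -
  have "zip (positions g) (map f (positions v)) ! k \<le> zip (positions g) (map f (positions v)) ! Suc k
      \<longleftrightarrow> (positions v ! k < positions v ! Suc k \<longrightarrow> positions g ! k < positions g ! Suc k)"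
    if k: "Suc k < sum_list v" for k
  proof -
    have v: "positions v ! k \<le> positions v ! Suc k" and g: "positions g ! k \<le> positions g ! Suc k"
      using sorted_positions k sums by (simp_all add: sorted_iff_nth_Suc)
    have "positions v ! k < positions v ! Suc k \<Longrightarrow> f (positions v ! Suc k) < f (positions v ! k)"
      using f positions_nth_less[OF k] by blast
    then show ?thesis
      using k sums v g by (cases "positions v ! k = positions v ! Suc k") auto
  qed
  then show ?thesis using sums by (simp add: sorted_iff_nth_Suc)
qed

lemma set_zip_positions:
  assumes "sum_list g = sum_list v"
  shows "set (zip (positions g) (map f (positions v)))
    = (\<lambda>k. (positions g ! k, f (positions v ! k))) ` {..<sum_list v}"
proof -
  have "zip (positions g) (map f (positions v))
      = map (\<lambda>k. (positions g ! k, f (positions v ! k))) [0..<sum_list v]"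
    by (rule nth_equalityI) (simp_all add: assms)
  then show ?thesis by (simp only: set_map set_upt atLeast0LessThan)
qed

text \<open>Letters are constant within a part and drop at the next one. So lexicographic sortedness
  forces a strict step in position exactly where the part changes, which is the second condition of
  \<open>slide_set_iff\<close>.\<close>

lemma slide_set_pairs:
  assumes len: "length g = length v" and sums: "sum_list g = sum_list v"
    and f: "\<And>p q. p < q \<Longrightarrow> q < length v \<Longrightarrow> (f q :: nat) < f p"
    and h: "\<And>p. p < length v \<Longrightarrow> h (f p) = p"
  defines "L \<equiv> zip (positions g) (map f (positions v))"
  shows "g \<in> slide_set v \<longleftrightarrow> sorted L \<and> (\<forall>(p, l) \<in> set L. p \<le> h l)"
proof -
  have "(\<forall>(p, l) \<in> set L. p \<le> h l) \<longleftrightarrow> (\<forall>k < sum_list v. positions g ! k \<le> positions v ! k)"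
    unfolding L_def using positions_nth_less[of _ v]
    by (auto simp: set_zip_positions[OF sums] h)
  moreover have "sorted L \<longleftrightarrow> (\<forall>k. Suc k < sum_list v \<longrightarrow> positions v ! k < positions v ! Suc k \<longrightarrow>
      positions g ! k < positions g ! Suc k)"
    unfolding L_def using f by (intro sorted_zip_positions_iff[OF sums])
  ultimately show ?thesis using slide_set_iff[OF len sums] by blast
qed

lemma atom_set_pairs:
  assumes len: "length g = length v" and sums: "sum_list g = sum_list v"
    and f: "\<And>p q. p < q \<Longrightarrow> q < length v \<Longrightarrow> (f q :: nat) < f p"
    and h: "\<And>p. p < length v \<Longrightarrow> h (f p) = p"
  defines "L \<equiv> zip (positions g) (map f (positions v))"
  shows "g \<in> atom_set v \<longleftrightarrow> sorted L \<and> (\<forall>(p, l) \<in> set L. p \<le> h l) \<and>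
    (\<forall>(p, l) \<in> set L. (h l, l) \<in> set L)"
proof -
  have in_L: "(p, f q) \<in> set L \<longleftrightarrow>
      (\<exists>m < sum_list v. positions v ! m = q \<and> positions g ! m = p)" if "q < length v" for p q
  proof -
    have inj: "f q = f (positions v ! m) \<longleftrightarrow> positions v ! m = q" if "m < sum_list v" for m
      using h[OF \<open>q < length v\<close>] h[OF positions_nth_less[OF that]] by metis
    have "(p, f q) \<in> set L \<longleftrightarrow>
        (\<exists>m < sum_list v. p = positions g ! m \<and> f q = f (positions v ! m))"
      unfolding L_def set_zip_positions[OF sums] by auto
    then show ?thesis using inj by blast
  qed
  have "(\<forall>(p, l) \<in> set L. (h l, l) \<in> set L) \<longleftrightarrow>
      (\<forall>k < sum_list v. (positions v ! k, f (positions v ! k)) \<in> set L)"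
  proof -
    have "h (f (positions v ! k)) = positions v ! k" if "k < sum_list v" for k
      using h positions_nth_less[OF that] by blast
    moreover have "(\<forall>(p, l) \<in> set L. P l) \<longleftrightarrow> (\<forall>k < sum_list v. P (f (positions v ! k)))" for P
      unfolding L_def set_zip_positions[OF sums] by auto
    ultimately show ?thesis by simp
  qed
  also have "\<dots> \<longleftrightarrow> (\<forall>k < sum_list v. \<exists>m < sum_list v. positions v ! m = positions v ! k \<and>
      positions g ! m = positions v ! k)"
    using in_L positions_nth_less[of _ v] by simp
  finally show ?thesis
    using atom_set_iff[OF len sums] slide_set_pairs[OF len sums, of f h] f h
    unfolding L_def by blast
qed

subsection \<open>Pushing letters to the end of their run\<close>

text \<open>A filling is a list of pairs (position, letter), sorted lexicographically. Pushing moves every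
  letter to the position of the last letter of its weakly increasing run.\<close>

fun push :: "(nat \<times> nat) list \<Rightarrow> (nat \<times> nat) list" where
  "push [] = []"
| "push [x] = [x]"
| "push (x # y # L) = (if snd x \<le> snd y then (fst (hd (push (y # L))), snd x) else x) # push (y # L)"

lemma length_push [simp]: "length (push L) = length L"
  by (induction L rule: push.induct) simp_all

lemma map_snd_push [simp]: "map snd (push L) = map snd L"
  by (induction L rule: push.induct) simp_all

lemma snd_push_nth [simp]: "k < length L \<Longrightarrow> snd (push L ! k) = snd (L ! k)"
  by (metis length_push map_snd_push nth_map)

lemma push_nth:
  "k < length L \<Longrightarrow> push L ! k =
    (if Suc k < length L \<and> snd (L ! k) \<le> snd (L ! Suc k)
     then (fst (push L ! Suc k), snd (L ! k)) else L ! k)"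
proof (induction L arbitrary: k rule: push.induct)
  case (3 x y L)
  have "push (y # L) \<noteq> []" by (metis length_push list.distinct(1) length_0_conv)
  then show ?case using 3 by (cases k) (auto simp: hd_conv_nth)
qed simp_all

text \<open>The witness \<open>m\<close> is the last index of the weakly increasing run through
  \<open>k\<close>; its letter is not moved.\<close>

lemma push_run_end:
  assumes "k < length L"
  shows "\<exists>m. k \<le> m \<and> m < length L \<and> snd (L ! k) \<le> snd (L ! m) \<and>
    push L ! m = L ! m \<and> fst (push L ! k) = fst (L ! m)"
  using assms
proof (induction "length L - k" arbitrary: k rule: less_induct)
  case less
  show ?case
  proof (cases "Suc k < length L \<and> snd (L ! k) \<le> snd (L ! Suc k)")
    case True
    have "length L - Suc k < length L - k" using less.prems by arith
    from less.hyps[OF this] True obtain m where "Suc k \<le> m" "m < length L"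
        "snd (L ! Suc k) \<le> snd (L ! m)" "push L ! m = L ! m" "fst (push L ! Suc k) = fst (L ! m)"
      by blast
    then show ?thesis using True push_nth[OF less.prems] by (intro exI[of _ m]) auto
  next
    case False
    then show ?thesis using push_nth[OF less.prems] less.prems by (intro exI[of _ k]) auto
  qed
qed

lemma fst_le_push:
  assumes "sorted L" and "k < length L"
  shows "fst (L ! k) \<le> fst (push L ! k)"
proof -
  obtain m where m: "k \<le> m" "m < length L" "fst (push L ! k) = fst (L ! m)"
    using push_run_end[OF assms(2)] by blast
  then have "L ! k \<le> L ! m" using assms(1) by (intro sorted_nth_mono)
  then show ?thesis using m by (auto simp: less_eq_prod_def)
qed

text \<open>Inside a run all positions become equal while the letters increase. At a descent,
  sortedness makes the position jump, the left letter stays, and the right one only moves further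
  right.\<close>

lemma sorted_push:
  assumes "sorted L"
  shows "sorted (push L)"
proof -
  have "push L ! k \<le> push L ! Suc k" if k: "Suc k < length L" for k
  proof (cases "snd (L ! k) \<le> snd (L ! Suc k)")
    case True
    then show ?thesis using push_nth[of k L] k by (simp add: less_eq_prod_def)
  next
    case False
    have "L ! k \<le> L ! Suc k" using assms k by (simp add: sorted_iff_nth_Suc)
    then have "fst (L ! k) < fst (L ! Suc k)" using False by (auto simp: less_eq_prod_def)
    also have "\<dots> \<le> fst (push L ! Suc k)" using fst_le_push[OF assms k] .
    finally show ?thesis using push_nth[of k L] k False by (simp add: less_eq_prod_def)
  qed
  then show ?thesis by (simp add: sorted_iff_nth_Suc)
qed

lemma push_push: "push (push L) = push L"
proof (rule nth_equalityI)
  fix k assume "k < length (push (push L))"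
  then have "k < length L" by simp
  then show "push (push L) ! k = push L ! k"
  proof (induction "length L - k" arbitrary: k rule: less_induct)
    case less
    then show ?case
      using less.hyps[of "Suc k"] push_nth[of k "push L"] push_nth[of k L] by auto
  qed
qed simp

text \<open>On neighbours this describes the sorted fixed points of \<open>push\<close>: the
  position jumps exactly where the letter drops.\<close>

definition tight :: "nat \<times> nat \<Rightarrow> nat \<times> nat \<Rightarrow> bool" where
  "tight x y \<longleftrightarrow> fst x = fst y \<and> snd x \<le> snd y \<or> fst x < fst y \<and> snd x > snd y"

lemma successively_conv_nth:
  "successively P xs \<longleftrightarrow> (\<forall>k. Suc k < length xs \<longrightarrow> P (xs ! k) (xs ! Suc k))"
proof (induction P xs rule: successively.induct)
  case (3 P x y xs)
  show ?case
  proof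
    assume "successively P (x # y # xs)"
    then have "P x y" "\<forall>k. Suc k < length (y # xs) \<longrightarrow> P ((y # xs) ! k) ((y # xs) ! Suc k)"
      using 3 by auto
    then have "P ((x # y # xs) ! k) ((x # y # xs) ! Suc k)" if "Suc k < length (x # y # xs)" for k
      using that by (cases k) auto
    then show "\<forall>k. Suc k < length (x # y # xs) \<longrightarrow> P ((x # y # xs) ! k) ((x # y # xs) ! Suc k)"
      by blast
  next
    assume a: "\<forall>k. Suc k < length (x # y # xs) \<longrightarrow> P ((x # y # xs) ! k) ((x # y # xs) ! Suc k)"
    have "P ((y # xs) ! k) ((y # xs) ! Suc k)" if "Suc k < length (y # xs)" for k
      using a[rule_format, of "Suc k"] that by simp
    then show "successively P (x # y # xs)" using 3 a[rule_format, of 0] by simp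
  qed
qed simp_all

lemma tight_iff: "successively tight Q \<longleftrightarrow> sorted Q \<and> push Q = Q"
proof
  assume t: "successively tight Q"
  have T: "tight (Q ! k) (Q ! Suc k)" if "Suc k < length Q" for k
    using t that by (simp add: successively_conv_nth)
  have "Q ! k \<le> Q ! Suc k" if "Suc k < length Q" for k
    using T[OF that] by (auto simp: less_eq_prod_def tight_def)
  then have "sorted Q" by (simp add: sorted_iff_nth_Suc)
  moreover have "push Q = Q"
  proof (rule nth_equalityI)
    fix k assume "k < length (push Q)"
    then have "k < length Q" by simp
    then show "push Q ! k = Q ! k"
    proof (induction "length Q - k" arbitrary: k rule: less_induct)
      case less
      then show ?case
        using less.hyps[of "Suc k"] push_nth[of k Q] T[of k] by (auto simp: tight_def prod_eq_iff)
    qed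
  qed simp
  ultimately show "sorted Q \<and> push Q = Q" ..
next
  assume Q: "sorted Q \<and> push Q = Q"
  have "tight (Q ! k) (Q ! Suc k)" if k: "Suc k < length Q" for k
  proof -
    have "Q ! k \<le> Q ! Suc k" using Q k by (simp add: sorted_iff_nth_Suc)
    moreover have "snd (Q ! k) \<le> snd (Q ! Suc k) \<Longrightarrow> fst (Q ! k) = fst (Q ! Suc k)"
      using push_nth[of k Q] Q k by (metis Suc_lessD fst_conv)
    ultimately show ?thesis by (auto simp: tight_def less_eq_prod_def not_le)
  qed
  then show "successively tight Q" by (simp add: successively_conv_nth)
qed

text \<open>The part index of the letters \<open>2(n - p) - 1\<close> and \<open>2(n - p)\<close> is \<open>p\<close>.\<close>

definition part_index :: "nat \<Rightarrow> nat \<Rightarrow> nat" where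
  "part_index n l = n - (l + 1) div 2"

lemma part_index_antimono: "l \<le> m \<Longrightarrow> part_index n m \<le> part_index n l"
  by (simp add: part_index_def div_le_mono diff_le_mono2)

text \<open>Of the two positive letters with the same part index the even one is the larger. The
  bound on \<open>m\<close> keeps the subtraction in \<open>part_index\<close> from being
  truncated.\<close>

lemma part_index_inj:
  assumes "even l" and "l \<le> m" and "m \<le> 2 * n" and "part_index n l \<le> part_index n m"
  shows "l = m"
  using assms unfolding part_index_def by presburger

text \<open>The position bound is common to both factors; the anchoring condition is demanded only
  of even letters, which come from the atom factor.\<close>

definition admissible :: "nat \<Rightarrow> (nat \<times> nat) list \<Rightarrow> bool" where
  "admissible n L \<longleftrightarrow> (\<forall>(p, l) \<in> set L. p \<le> part_index n l) \<and>
     (\<forall>(p, l) \<in> set L. even l \<longrightarrow> (part_index n l, l) \<in> set L)"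

text \<open>An even letter already at its bound cannot move. Conversely, if it reaches its bound by
  pushing, the letter ending its run sits there and so has at least that part index; by
  \<open>part_index_inj\<close> it is the same letter, anchored before pushing.\<close>

lemma admissible_push:
  assumes L: "sorted L" and bounds: "\<forall>l \<in> set (map snd L). l \<le> 2 * n"
  shows "admissible n (push L) \<longleftrightarrow> admissible n L"
proof
  assume a: "admissible n L"
  have le: "p \<le> part_index n l" if "(p, l) \<in> set L" for p l
    using a that by (auto simp: admissible_def)
  have le_push: "fst (push L ! k) \<le> part_index n (snd (L ! k))" if k: "k < length L" for k
  proof -
    obtain m where m: "m < length L" "snd (L ! k) \<le> snd (L ! m)" "fst (push L ! k) = fst (L ! m)"
      using push_run_end[OF k] by blast
    have "fst (L ! m) \<le> part_index n (snd (L ! m))" using le m(1) by simp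
    then show ?thesis using m part_index_antimono[OF m(2), of n] by simp
  qed
  have "(part_index n l, l) \<in> set (push L)" if pl: "(p, l) \<in> set (push L)" "even l" for p l
  proof -
    obtain i where i: "i < length L" "push L ! i = (p, l)" using pl by (auto simp: in_set_conv_nth)
    then have "(fst (L ! i), l) \<in> set L" using snd_push_nth[OF i(1)] nth_mem[OF i(1)]
      by (metis prod.collapse snd_conv)
    then have "(part_index n l, l) \<in> set L" using a pl(2) by (auto simp: admissible_def)
    then obtain k where k: "k < length L" "L ! k = (part_index n l, l)"
      by (auto simp: in_set_conv_nth)
    then have "push L ! k = (part_index n l, l)"
      using le_push[OF k(1)] fst_le_push[OF L k(1)] by (auto simp: prod_eq_iff)
    then show ?thesis using k by (metis length_push nth_mem)
  qed
  moreover have "p \<le> part_index n l" if pl: "(p, l) \<in> set (push L)" for p l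
  proof -
    obtain i where i: "i < length L" "push L ! i = (p, l)" using pl by (auto simp: in_set_conv_nth)
    then show ?thesis using le_push[OF i(1)] snd_push_nth[OF i(1)] by simp
  qed
  ultimately show "admissible n (push L)" by (auto simp: admissible_def)
next
  assume a: "admissible n (push L)"
  have le: "p \<le> part_index n l" if "(p, l) \<in> set (push L)" for p l
    using a that by (auto simp: admissible_def)
  have le_L: "p \<le> part_index n l" if pl: "(p, l) \<in> set L" for p l
  proof -
    obtain k where k: "k < length L" "L ! k = (p, l)" using pl by (auto simp: in_set_conv_nth)
    have "push L ! k \<in> set (push L)" "snd (push L ! k) = l" using k by simp_all
    then have "(fst (push L ! k), l) \<in> set (push L)" by (metis prod.collapse)
    then have "fst (push L ! k) \<le> part_index n l" by (rule le)
    then show ?thesis using fst_le_push[OF L k(1)] k by simp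
  qed
  moreover have "(part_index n l, l) \<in> set L" if pl: "(p, l) \<in> set L" "even l" for p l
  proof -
    obtain i where i: "i < length L" "L ! i = (p, l)" using pl by (auto simp: in_set_conv_nth)
    have "push L ! i \<in> set (push L)" "snd (push L ! i) = l" using i by simp_all
    then have "(fst (push L ! i), l) \<in> set (push L)" by (metis prod.collapse)
    then have "(part_index n l, l) \<in> set (push L)" using a pl(2) by (auto simp: admissible_def)
    then obtain k where k: "k < length L" "push L ! k = (part_index n l, l)"
      by (auto simp: in_set_conv_nth)
    then have lk: "snd (L ! k) = l" using snd_push_nth[OF k(1)] by simp
    obtain m where m: "m < length L" "l \<le> snd (L ! m)" "fst (L ! m) = part_index n l"
      using push_run_end[OF k(1)] k lk by auto
    have "(part_index n l, snd (L ! m)) \<in> set L" using m(1,3) by (metis nth_mem prod.collapse)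
    then have "part_index n l \<le> part_index n (snd (L ! m))" by (rule le_L)
    moreover have "snd (L ! m) \<le> 2 * n" using bounds m(1) by simp
    ultimately have "l = snd (L ! m)" using part_index_inj[OF pl(2) m(2)] by simp
    then have "L ! m = (part_index n l, l)" using m by (simp add: prod_eq_iff)
    then show ?thesis using m(1) by (metis nth_mem)
  qed
  ultimately show "admissible n L" by (auto simp: admissible_def)
qed

text \<open>The monomials of an atom are the ways to spread the runs of a word over earlier positions.\<close>

lemma atom_set_iff_push:
  assumes len: "length g = length v" and sums: "sum_list g = sum_list v"
    and C: "length C = sum_list v"
    and t: "successively tight (zip (positions v) C)"
  shows "g \<in> atom_set v \<longleftrightarrow>
    sorted (zip (positions g) C) \<and> push (zip (positions g) C) = zip (positions v) C"
proof -
  define c q N where "c = positions g" and "q = positions v" and "N = sum_list v"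
  let ?L = "zip c C"
  have lens: "length c = N" "length q = N" "length C = N"
    using sums C by (simp_all add: c_def q_def N_def)
  have tight: "q ! k = q ! Suc k \<and> C ! k \<le> C ! Suc k \<or> q ! k < q ! Suc k \<and> C ! k > C ! Suc k"
    if "Suc k < N" for k
    using t that lens by (auto simp: successively_conv_nth tight_def q_def)
  have sc: "c ! k \<le> c ! Suc k" if "Suc k < N" for k
    using sorted_positions[of g] that lens by (simp add: sorted_iff_nth_Suc c_def)
  have sq: "q ! k \<le> q ! m" if "k \<le> m" "m < N" for k m
    using sorted_positions[of v] that lens by (simp add: sorted_nth_mono q_def)
  have mono_c: "c ! k \<le> c ! m" if "k \<le> m" "m < N" for k m
    using sorted_positions[of g] that lens by (simp add: sorted_nth_mono c_def)
  have sorted_L: "sorted ?L \<longleftrightarrow>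
      (\<forall>k. Suc k < N \<longrightarrow> C ! k > C ! Suc k \<longrightarrow> c ! k < c ! Suc k)"
    using sc lens by (force simp: sorted_iff_nth_Suc)
  have atom: "g \<in> atom_set v \<longleftrightarrow> (\<forall>k < N. c ! k \<le> q ! k) \<and>
      (\<forall>k. Suc k < N \<longrightarrow> q ! k < q ! Suc k \<longrightarrow> c ! k < c ! Suc k) \<and>
      (\<forall>k < N. \<exists>m < N. q ! m = q ! k \<and> c ! m = q ! k)"
    using atom_set_iff[OF len sums] slide_set_iff[OF len sums] by (simp add: c_def q_def N_def)
  have "sorted ?L \<and> push ?L = zip q C" if g: "g \<in> atom_set v"
  proof
    have s: "sorted ?L"
      unfolding sorted_L using g tight unfolding atom by (metis less_asym less_irrefl not_le)
    then show "sorted ?L" .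
    show "push ?L = zip q C"
    proof (rule nth_equalityI)
      fix k assume "k < length (push ?L)"
      then have "k < N" using lens by simp
      then show "push ?L ! k = zip q C ! k"
      proof (induction "N - k" arbitrary: k rule: less_induct)
        case less
        show ?case
        proof (cases "Suc k < N \<and> C ! k \<le> C ! Suc k")
          case True
          then have "push ?L ! Suc k = zip q C ! Suc k" using less by auto
          moreover have "q ! k = q ! Suc k" using tight[of k] True by auto
          ultimately show ?thesis using push_nth[of k ?L] True lens less.prems by simp
        next
          case False
          \<comment> \<open>At the end of a run, the unit of the same part that \<open>g\<close>
            keeps in place cannot come later than \<open>k\<close>; by monotonicity and the upper
            bound, \<open>k\<close> stays in place as well.\<close>
          obtain m where m: "m < N" "q ! m = q ! k" "c ! m = q ! k"
            using g less.prems unfolding atom by blast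
          have "m \<le> k"
          proof (rule ccontr)
            assume "\<not> m \<le> k"
            then have "Suc k \<le> m" by simp
            moreover have "q ! k < q ! Suc k" using tight[of k] False calculation m(1) by auto
            ultimately show False using sq[of "Suc k" m] m by simp
          qed
          then have "q ! k \<le> c ! k" using mono_c[of m k] m less.prems by simp
          moreover have "c ! k \<le> q ! k" using g less.prems unfolding atom by blast
          ultimately show ?thesis using push_nth[of k ?L] False lens less.prems by auto
        qed
      qed
    qed (simp add: lens)
  qed
  moreover have "g \<in> atom_set v" if s: "sorted ?L" and p: "push ?L = zip q C"
  proof -
    have "c ! k \<le> q ! k" if "k < N" for k
      using fst_le_push[OF s, of k] p that lens by simp
    moreover have "c ! k < c ! Suc k" if "Suc k < N" "q ! k < q ! Suc k" for k
      using s that tight[of k] unfolding sorted_L by auto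
    \<comment> \<open>The last letter of the run through \<open>k\<close> is fixed by
      \<open>push\<close>; it is the unit left in place.\<close>
    moreover have "\<exists>m < N. q ! m = q ! k \<and> c ! m = q ! k" if k: "k < N" for k
    proof -
      obtain m where "m < N" "push ?L ! m = ?L ! m" "fst (push ?L ! k) = fst (?L ! m)"
        using push_run_end[of k ?L] k lens by auto
      then show ?thesis using p k lens by (intro exI[of _ m]) auto
    qed
    ultimately show ?thesis unfolding atom by blast
  qed
  ultimately show ?thesis unfolding c_def q_def by blast
qed

subsection \<open>Products as sums over fillings\<close>

definition A_letters :: "nat list \<Rightarrow> nat list" where
  "A_letters \<alpha> = map (\<lambda>p. 2 * (length \<alpha> - p) - 1) (positions \<alpha>)"

definition B_letters :: "nat list \<Rightarrow> nat list" where
  "B_letters \<beta> = map (\<lambda>p. 2 * (length \<beta> - p)) (positions \<beta>)"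

lemma length_A_letters [simp]: "length (A_letters \<alpha>) = sum_list \<alpha>"
  by (simp add: A_letters_def)

lemma length_B_letters [simp]: "length (B_letters \<beta>) = sum_list \<beta>"
  by (simp add: B_letters_def)

lemma A_word_letters: "A_word \<alpha> = map Some (A_letters \<alpha>)"
  by (simp add: A_word_def A_letters_def positions_def map_concat o_def map_replicate Let_def)

lemma B_word_letters: "B_word \<beta> = map Some (B_letters \<beta>)"
  by (simp add: B_word_def B_letters_def positions_def map_concat o_def map_replicate Let_def)

lemma A_letter: "l \<in> set (A_letters \<alpha>) \<Longrightarrow>
    odd l \<and> l \<le> 2 * length \<alpha> \<and> part_index (length \<alpha>) l < length \<alpha>"
  using set_positions[of \<alpha>] by (auto simp: A_letters_def part_index_def)

lemma B_letter: "l \<in> set (B_letters \<beta>) \<Longrightarrow>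
    even l \<and> l \<le> 2 * length \<beta> \<and> part_index (length \<beta>) l < length \<beta>"
  using set_positions[of \<beta>] by (auto simp: B_letters_def part_index_def)

lemma slide_set_A_letters:
  assumes "length g = length \<alpha>" and "sum_list g = sum_list \<alpha>"
  shows "g \<in> slide_set \<alpha> \<longleftrightarrow> sorted (zip (positions g) (A_letters \<alpha>)) \<and>
    (\<forall>(p, l) \<in> set (zip (positions g) (A_letters \<alpha>)). p \<le> part_index (length \<alpha>) l)"
  unfolding A_letters_def using assms
  by (intro slide_set_pairs) (auto simp: part_index_def)

lemma atom_set_B_letters:
  assumes "length g = length \<beta>" and "sum_list g = sum_list \<beta>"
  shows "g \<in> atom_set \<beta> \<longleftrightarrow> sorted (zip (positions g) (B_letters \<beta>)) \<and>
    admissible (length \<beta>) (zip (positions g) (B_letters \<beta>))"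
proof -
  have "even l" if "(p, l) \<in> set (zip (positions g) (B_letters \<beta>))" for p l
    using that B_letter[of l \<beta>] by (auto dest: set_zip_rightD)
  then have "admissible (length \<beta>) (zip (positions g) (B_letters \<beta>)) \<longleftrightarrow>
    (\<forall>(p, l) \<in> set (zip (positions g) (B_letters \<beta>)). p \<le> part_index (length \<beta>) l) \<and>
    (\<forall>(p, l) \<in> set (zip (positions g) (B_letters \<beta>)).
      (part_index (length \<beta>) l, l) \<in> set (zip (positions g) (B_letters \<beta>)))"
    unfolding admissible_def by fast
  moreover have "g \<in> atom_set \<beta> \<longleftrightarrow> sorted (zip (positions g) (B_letters \<beta>)) \<and>
    (\<forall>(p, l) \<in> set (zip (positions g) (B_letters \<beta>)). p \<le> part_index (length \<beta>) l) \<and>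
    (\<forall>(p, l) \<in> set (zip (positions g) (B_letters \<beta>)).
      (part_index (length \<beta>) l, l) \<in> set (zip (positions g) (B_letters \<beta>)))"
    unfolding B_letters_def using assms by (intro atom_set_pairs) (auto simp: part_index_def)
  ultimately show ?thesis by simp
qed

text \<open>Letters enter through the two parity filters of \<open>map snd\<close>, which
  \<open>push\<close> leaves unchanged; this reduces invariance under pushing to sortedness and
  admissibility.\<close>

definition fillings :: "nat list \<Rightarrow> nat list \<Rightarrow> (nat \<times> nat) list set" where
  "fillings \<alpha> \<beta> = {L. sorted L \<and> admissible (length \<alpha>) L \<and>
     filter odd (map snd L) = A_letters \<alpha> \<and> filter even (map snd L) = B_letters \<beta>}"

definition odd_part :: "(nat \<times> nat) list \<Rightarrow> (nat \<times> nat) list" where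
  "odd_part L = filter (\<lambda>x. odd (snd x)) L"

definition even_part :: "(nat \<times> nat) list \<Rightarrow> (nat \<times> nat) list" where
  "even_part L = filter (\<lambda>x. even (snd x)) L"

lemma map_snd_odd_part: "map snd (odd_part L) = filter odd (map snd L)"
  by (simp add: odd_part_def filter_map o_def)

lemma map_snd_even_part: "map snd (even_part L) = filter even (map snd L)"
  by (simp add: even_part_def filter_map o_def)

lemma admissible_iff_parts:
  "admissible n L \<longleftrightarrow> (\<forall>(p, l) \<in> set (odd_part L). p \<le> part_index n l) \<and> admissible n (even_part L)"
  unfolding admissible_def odd_part_def even_part_def by auto

lemma fillings_letters:
  assumes L: "filter odd (map snd L) = A_letters \<alpha>" "filter even (map snd L) = B_letters \<beta>"
    and len: "length \<beta> = length \<alpha>" and l: "l \<in> set (map snd L)"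
  shows "l \<le> 2 * length \<alpha> \<and> part_index (length \<alpha>) l < length \<alpha>"
proof (cases "odd l")
  case True
  then have "l \<in> set (filter odd (map snd L))" using l by simp
  then show ?thesis using A_letter[of l \<alpha>] L by simp
next
  case False
  then have "l \<in> set (filter even (map snd L))" using l by simp
  then show ?thesis using B_letter[of l \<beta>] L len by simp
qed

lemma fillings_fst_less:
  assumes L: "L \<in> fillings \<alpha> \<beta>" and len: "length \<beta> = length \<alpha>" and p: "(p, l) \<in> set L"
  shows "p < length \<alpha>"
proof -
  have "p \<le> part_index (length \<alpha>) l" using L p by (auto simp: fillings_def admissible_def)
  moreover have "l \<in> set (map snd L)" using p by force
  then have "part_index (length \<alpha>) l < length \<alpha>"
    using fillings_letters[OF _ _ len] L by (auto simp: fillings_def)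
  ultimately show ?thesis by simp
qed

lemma finite_fillings:
  assumes len: "length \<beta> = length \<alpha>"
  shows "finite (fillings \<alpha> \<beta>)"
proof -
  have "fillings \<alpha> \<beta> \<subseteq> {L. set L \<subseteq> {..<length \<alpha>} \<times> {..2 * length \<alpha>} \<and>
      length L = sum_list \<alpha> + sum_list \<beta>}"
  proof
    fix L assume L: "L \<in> fillings \<alpha> \<beta>"
    have "x \<in> {..<length \<alpha>} \<times> {..2 * length \<alpha>}" if x: "x \<in> set L" for x
    proof -
      obtain p l where pl: "x = (p, l)" by (cases x)
      have "l \<in> set (map snd L)" using x pl by force
      then have "l \<le> 2 * length \<alpha>" using fillings_letters[OF _ _ len] L by (auto simp: fillings_def)
      then show ?thesis using fillings_fst_less[OF L len, of p l] x pl by simp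
    qed
    moreover have "length (map snd L) = sum_list \<alpha> + sum_list \<beta>"
    proof -
      have "length (filter odd (map snd L)) + length (filter even (map snd L)) = length (map snd L)"
        using sum_length_filter_compl[of odd "map snd L"] by simp
      then show ?thesis using L by (simp only: fillings_def mem_Collect_eq length_A_letters length_B_letters)
    qed
    ultimately show "L \<in> {L. set L \<subseteq> {..<length \<alpha>} \<times> {..2 * length \<alpha>} \<and>
        length L = sum_list \<alpha> + sum_list \<beta>}"
      by auto
  qed
  then show ?thesis by (rule finite_subset) (intro finite_lists_length_eq finite_cartesian_product; simp)
qed

lemma sorted_map_fst: "sorted L \<Longrightarrow> sorted (map fst L)" for L :: "(nat \<times> nat) list"
  by (rule sorted_wrt_map_mono[of "(\<le>)" L "(\<le>)" fst, simplified]) (auto simp: less_eq_prod_def)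

abbreviation weight :: "(nat \<times> nat) list \<Rightarrow> poly" where
  "weight L \<equiv> prod_list (map var (map fst L))"

text \<open>The parity of a letter tells which factor it comes from, so merging two sorted lists is
  undone by filtering. The weight depends only on the multiset of positions, hence is multiplicative
  under merging.\<close>

lemma mono_sum_product:
  assumes len: "length \<beta> = length \<alpha>"
  shows "mono_sum (slide_set \<alpha>) * mono_sum (atom_set \<beta>) = (\<Sum>L\<in>fillings \<alpha> \<beta>. weight L)"
proof -
  let ?n = "length \<alpha>"
  define merge where "merge = (\<lambda>(a, b).
    sort (zip (positions a) (A_letters \<alpha>) @ zip (positions b) (B_letters \<beta>)))"
  define split where "split = (\<lambda>L.
    (counts ?n (map fst (odd_part L)), counts ?n (map fst (even_part L))))"
  have "mono_sum (slide_set \<alpha>) * mono_sum (atom_set \<beta>)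
      = (\<Sum>(a, b)\<in>slide_set \<alpha> \<times> atom_set \<beta>. monomial_of a * monomial_of b)"
    by (simp add: sum_product sum.cartesian_product)
  also have "\<dots> = (\<Sum>L\<in>fillings \<alpha> \<beta>. weight L)"
  proof (rule sum.reindex_bij_witness[of _ split merge])
    fix x assume x: "x \<in> slide_set \<alpha> \<times> atom_set \<beta>"
    obtain a b where ab: "x = (a, b)" by (cases x)
    let ?Za = "zip (positions a) (A_letters \<alpha>)" and ?Zb = "zip (positions b) (B_letters \<beta>)"
    have a: "a \<in> slide_set \<alpha>" "length a = ?n" "sum_list a = sum_list \<alpha>"
      and b: "b \<in> atom_set \<beta>" "length b = length \<beta>" "sum_list b = sum_list \<beta>"
      using x ab by (auto simp: slide_set_def atom_set_def)
    have A: "sorted ?Za" "\<forall>(p, l) \<in> set ?Za. p \<le> part_index ?n l"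
      using a slide_set_A_letters[OF a(2,3)] by blast+
    have B: "sorted ?Zb" "admissible ?n ?Zb"
      using b atom_set_B_letters[OF b(2,3)] len by simp_all
    have m: "merge x = sort (?Za @ ?Zb)" by (simp add: merge_def ab)
    have "\<forall>y \<in> set ?Za. odd (snd y)" using A_letter[of _ \<alpha>] by (auto dest: set_zip_rightD)
    moreover have "\<forall>y \<in> set ?Zb. even (snd y)" using B_letter[of _ \<beta>] by (auto dest: set_zip_rightD)
    ultimately have filters: "filter (\<lambda>y. odd (snd y)) (?Za @ ?Zb) = ?Za"
        "filter (\<lambda>y. even (snd y)) (?Za @ ?Zb) = ?Zb"
      by (auto simp: filter_empty_conv filter_id_conv)
    have parts: "odd_part (merge x) = ?Za" "even_part (merge x) = ?Zb"
      unfolding m odd_part_def even_part_def filter_sort filters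
      using A(1) B(1) by (simp_all add: sorted_sort_id)
    have fst_snd: "map fst ?Za = positions a" "map snd ?Za = A_letters \<alpha>"
        "map fst ?Zb = positions b" "map snd ?Zb = B_letters \<beta>"
      using a b by simp_all
    show "split (merge x) = x"
      unfolding split_def parts fst_snd using counts_positions[of a] counts_positions[of b] a b len ab
      by simp
    show "merge x \<in> fillings \<alpha> \<beta>"
      unfolding fillings_def mem_Collect_eq admissible_iff_parts[of _ "merge x"] map_snd_odd_part[symmetric]
        map_snd_even_part[symmetric] parts fst_snd
      using A B m by simp
    have "mset (map var (map fst (merge x))) = mset (map var (map fst (?Za @ ?Zb)))"
      by (simp only: m mset_map mset_sort)
    then have "weight (merge x) = weight (?Za @ ?Zb)" by (metis prod_mset_prod_list)
    also have "\<dots> = weight ?Za * weight ?Zb" by (simp only: map_append prod_list.append)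
    finally show "weight (merge x) = (case x of (a, b) \<Rightarrow> monomial_of a * monomial_of b)"
      by (simp only: fst_snd ab monomial_of_positions prod.case)
  next
    fix L assume L: "L \<in> fillings \<alpha> \<beta>"
    then have sL: "sorted L" and adm: "admissible ?n L"
      and snds: "map snd (odd_part L) = A_letters \<alpha>" "map snd (even_part L) = B_letters \<beta>"
      by (simp_all add: fillings_def map_snd_odd_part map_snd_even_part)
    have s: "sorted (odd_part L)" "sorted (even_part L)"
      using sL by (simp_all add: odd_part_def even_part_def sorted_wrt_filter)
    have less: "set (map fst (odd_part L)) \<subseteq> {..<?n}" "set (map fst (even_part L)) \<subseteq> {..<?n}"
      using fillings_fst_less[OF L len] by (auto simp: odd_part_def even_part_def)
    let ?a = "counts ?n (map fst (odd_part L))" and ?b = "counts ?n (map fst (even_part L))"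
    have pos: "positions ?a = map fst (odd_part L)" "positions ?b = map fst (even_part L)"
      using positions_counts sorted_map_fst s less by blast+
    have "length (map snd (odd_part L)) = sum_list \<alpha>" "length (map snd (even_part L)) = sum_list \<beta>"
      unfolding snds by simp_all
    then have sums: "sum_list ?a = sum_list \<alpha>" "sum_list ?b = sum_list \<beta>"
      using sum_list_counts sorted_map_fst s less by simp_all
    have zips: "zip (positions ?a) (A_letters \<alpha>) = odd_part L" "zip (positions ?b) (B_letters \<beta>) = even_part L"
      unfolding pos snds[symmetric] by (simp_all add: zip_map_fst_snd)
    have "?a \<in> slide_set \<alpha>"
      using slide_set_A_letters[of ?a \<alpha>] sums zips s adm by (simp add: admissible_iff_parts[of _ L])
    moreover have "?b \<in> atom_set \<beta>"
      using atom_set_B_letters[of ?b \<beta>] sums zips s adm len by (simp add: admissible_iff_parts[of _ L])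
    ultimately show "split L \<in> slide_set \<alpha> \<times> atom_set \<beta>" by (simp add: split_def)
    have "mset L = mset (odd_part L @ even_part L)"
      by (simp add: odd_part_def even_part_def)
    then show "merge (split L) = L"
      unfolding split_def merge_def prod.case zips using sL by (intro properties_for_sort)
  qed
  finally show ?thesis .
qed

lemma push_in_fillings:
  assumes len: "length \<beta> = length \<alpha>" and s: "sorted L"
  shows "push L \<in> fillings \<alpha> \<beta> \<longleftrightarrow> L \<in> fillings \<alpha> \<beta>"
proof -
  have "admissible (length \<alpha>) (push L) \<longleftrightarrow> admissible (length \<alpha>) L"
    if "filter odd (map snd L) = A_letters \<alpha>" "filter even (map snd L) = B_letters \<beta>"
    using fillings_letters[OF that len] by (intro admissible_push[OF s]) blast
  then show ?thesis using s sorted_push[OF s] unfolding fillings_def mem_Collect_eq map_snd_push by blast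
qed

lemma sum_fillings_push:
  assumes len: "length \<beta> = length \<alpha>"
  shows "(\<Sum>L\<in>fillings \<alpha> \<beta>. weight L)
    = (\<Sum>Q\<in>{Q \<in> fillings \<alpha> \<beta>. successively tight Q}. \<Sum>L\<in>{L \<in> fillings \<alpha> \<beta>. push L = Q}. weight L)"
proof (rule sum.group[symmetric])
  show "push ` fillings \<alpha> \<beta> \<subseteq> {Q \<in> fillings \<alpha> \<beta>. successively tight Q}"
  proof
    fix Q assume "Q \<in> push ` fillings \<alpha> \<beta>"
    then obtain L where L: "L \<in> fillings \<alpha> \<beta>" "Q = push L" by blast
    then have "sorted L" by (simp add: fillings_def)
    then show "Q \<in> {Q \<in> fillings \<alpha> \<beta>. successively tight Q}"
      using L push_in_fillings[OF len] sorted_push push_push by (simp add: tight_iff)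
  qed
qed (simp_all add: finite_fillings[OF len])

text \<open>All fillings in a fibre share the letter sequence of \<open>Q\<close>, so such a filling
  is determined by its positions; \<open>atom_set_iff_push\<close> identifies the possible
  ones.\<close>

lemma sum_fillings_fibre:
  assumes len: "length \<beta> = length \<alpha>"
    and Q: "Q \<in> fillings \<alpha> \<beta>" "successively tight Q"
    and v: "length v = length \<alpha>" "positions v = map fst Q"
  shows "(\<Sum>L\<in>{L \<in> fillings \<alpha> \<beta>. push L = Q}. weight L) = mono_sum (atom_set v)"
proof (rule sum.reindex_bij_witness[of _ "\<lambda>g. zip (positions g) (map snd Q)"
      "\<lambda>L. counts (length \<alpha>) (map fst L)"])
  let ?n = "length \<alpha>" and ?C = "map snd Q"
  have C: "length ?C = sum_list v" using v by (metis length_map length_positions)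
  have Qz: "Q = zip (positions v) ?C" using v by (simp add: zip_map_fst_snd)
  have atom: "g \<in> atom_set v \<longleftrightarrow> sorted (zip (positions g) ?C) \<and> push (zip (positions g) ?C) = Q"
    if "length g = length v" "sum_list g = sum_list v" for g
    using atom_set_iff_push[OF that C] Q(2) Qz by simp
  {
    fix L assume "L \<in> {L \<in> fillings \<alpha> \<beta>. push L = Q}"
    then have L: "L \<in> fillings \<alpha> \<beta>" "push L = Q" by simp_all
    have s: "sorted L" using L by (simp add: fillings_def)
    have less: "set (map fst L) \<subseteq> {..<?n}" using fillings_fst_less[OF L(1) len] by auto
    let ?g = "counts ?n (map fst L)"
    have pos: "positions ?g = map fst L" using positions_counts[OF sorted_map_fst[OF s] less] .
    have snds: "map snd L = ?C" using L(2) map_snd_push[of L] by simp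
    show z: "zip (positions ?g) ?C = L" unfolding pos snds[symmetric] by (simp add: zip_map_fst_snd)
    have "sum_list ?g = length L" using sum_list_counts[OF sorted_map_fst[OF s] less] by simp
    also have "\<dots> = sum_list v" using C snds by (metis length_map)
    finally show "?g \<in> atom_set v" using atom[of ?g] v z s L(2) by simp
    show "monomial_of ?g = weight L" by (simp only: monomial_of_positions pos)
  next
    fix g assume g: "g \<in> atom_set v"
    then have lg: "length g = length v" "sum_list g = sum_list v" by (simp_all add: atom_set_def)
    let ?L = "zip (positions g) ?C"
    have s: "sorted ?L" "push ?L = Q" using atom[OF lg] g by simp_all
    have "map fst ?L = positions g" using lg C by simp
    then show "counts ?n (map fst ?L) = g" using counts_positions[of g] lg v by simp
    show "?L \<in> {L \<in> fillings \<alpha> \<beta>. push L = Q}"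
      using push_in_fillings[OF len s(1)] s Q(1) by simp
  }
qed

subsection \<open>Dominance, refinement and the fundamental shift\<close>

lemma dominated_iff: "dominated v g \<longleftrightarrow> (\<forall>j \<le> length v. psum v j \<le> psum g j)"
  by (simp add: dominated_def)

lemma dominated_positions:
  assumes "length g = length v" "sum_list g = sum_list v" "dominated v g" "k < sum_list v"
  shows "positions g ! k \<le> positions v ! k"
proof -
  let ?i = "Suc (positions v ! k)"
  have i: "?i \<le> length v" using positions_nth_less[OF assms(4)] by simp
  then have "k < psum v ?i" using positions_less_iff[OF assms(4) i] by simp
  also have "\<dots> \<le> psum g ?i" using assms(3) i by (simp add: dominated_iff)
  finally show ?thesis using positions_less_iff[of k g ?i] assms i by simp
qed

lemma psum_gap:
  assumes "\<And>k. j \<le> k \<Longrightarrow> k < i \<Longrightarrow> k < length v \<Longrightarrow> v ! k = 0"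
  shows "psum v i \<le> psum v j"
proof -
  consider "psum v i = 0"
    | k where "k < i" "k < length v" "v ! k \<noteq> 0" "psum v (Suc k) = psum v i"
    using psum_support[of i v] by metis
  then show ?thesis
  proof cases
    case 1
    then show ?thesis by (simp only: le0)
  next
    case 2
    then have "k < j" using assms[of k] not_le by blast
    then show ?thesis using 2 psum_mono[of "Suc k" j v] by simp
  qed
qed

text \<open>The largest amount that the next nonzero part, counted from \<open>j\<close> on, can
  send to the left while keeping one unit in place.\<close>

definition next_part :: "nat list \<Rightarrow> nat \<Rightarrow> nat" where
  "next_part v j = (let S = {i. i < length v \<and> v ! i \<noteq> 0 \<and> j \<le> i} in
     if S = {} then 0 else v ! Min S - 1)"

lemma next_part_self:
  assumes "j < length v" and "v ! j \<noteq> 0"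
  shows "next_part v j = v ! j - 1"
proof -
  have "Min {i. i < length v \<and> v ! i \<noteq> 0 \<and> j \<le> i} = j"
    using assms by (intro Min_eqI) auto
  then show ?thesis using assms by (auto simp: next_part_def Let_def)
qed

lemma next_part_Suc:
  assumes "v ! j = 0"
  shows "next_part v j = next_part v (Suc j)"
proof -
  have "v ! i \<noteq> 0 \<and> j \<le> i \<longleftrightarrow> v ! i \<noteq> 0 \<and> Suc j \<le> i" for i
    using assms by (cases "i = j") auto
  then show ?thesis by (simp add: next_part_def)
qed

lemma length_qshift [simp]: "length (qshift v) = length v"
  by (simp add: qshift_def Let_def)

text \<open>Treating the left border as a nonzero entry makes the clause for position 0 an instance
  of the one for positions following a nonzero entry.\<close>

lemma qshift_nth:
  assumes j: "j < length v"
  shows "qshift v ! j =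
    (if v ! j \<noteq> 0 then (if j = 0 \<or> v ! (j - 1) \<noteq> 0 then v ! j else 1)
     else if j = 0 \<or> v ! (j - 1) \<noteq> 0 then next_part v (Suc j) else 0)"
proof -
  let ?S = "{i. i < length v \<and> v ! i \<noteq> 0}"
  have inS: "k \<in> ?S \<longleftrightarrow> v ! k \<noteq> 0" if "k \<le> j" for k using that j by simp
  have q: "qshift v ! j =
      (if j \<in> ?S then (if j = 0 \<or> j - 1 \<in> ?S then v ! j else 1)
       else if j = 0 \<and> ?S \<noteq> {} then v ! Min ?S - 1
       else if j \<noteq> 0 \<and> j - 1 \<in> ?S \<and> (\<exists>i \<in> ?S. j < i) then v ! Min {i \<in> ?S. j < i} - 1
       else 0)"
    using j by (simp only: qshift_def Let_def nth_map_upt minus_nat.diff_0 add_0)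
  have later: "{i \<in> ?S. j < i} = {i. i < length v \<and> v ! i \<noteq> 0 \<and> Suc j \<le> i}" by auto
  have zero: "next_part v (Suc j) = (if ?S = {} then 0 else v ! Min ?S - 1)" if "j = 0" "v ! j = 0"
  proof -
    have "next_part v 0 = (if ?S = {} then 0 else v ! Min ?S - 1)"
      by (simp only: next_part_def Let_def le0 simp_thms)
    then show ?thesis using next_part_Suc[of v 0] that by simp
  qed
  have pos: "next_part v (Suc j)
      = (if \<exists>i \<in> ?S. j < i then v ! Min {i \<in> ?S. j < i} - 1 else 0)"
    unfolding next_part_def Let_def later[symmetric] by auto
  show ?thesis
  proof (cases "v ! j = 0")
    case False
    then show ?thesis unfolding q using inS[of j] inS[of "j - 1"] by simp
  next
    case True
    then have nj: "j \<notin> ?S" by simp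
    show ?thesis
    proof (cases "j = 0")
      case z: True
      have "qshift v ! j = (if ?S = {} then 0 else v ! Min ?S - 1)"
        unfolding q using nj z
        by (cases "?S = {}") (simp_all only: if_True if_False simp_thms not_True_eq_False)
      then show ?thesis using zero[OF z True] z True by (simp only: if_True if_False simp_thms)
    next
      case nz: False
      have "qshift v ! j = (if v ! (j - 1) \<noteq> 0 then next_part v (Suc j) else 0)"
        unfolding q pos using nj nz inS[of "j - 1", OF diff_le_self]
        by (cases "\<exists>i \<in> ?S. j < i"; cases "j - 1 \<in> ?S")
          (simp_all only: if_True if_False simp_thms if_cancel)
      then show ?thesis using nz True by (simp only: if_True if_False simp_thms)
    qed
  qed
qed

text \<open>This is the largest partial sum possible in \<open>atom_set v\<close>: it is fixed right
  after a nonzero entry, and elsewhere the next part may lend all its units but one.\<close>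

lemma psum_qshift:
  assumes "j \<le> length v"
  shows "psum (qshift v) j = psum v j + (if j = 0 \<or> v ! (j - 1) \<noteq> 0 then 0 else next_part v j)"
  using assms
proof (induction j)
  case (Suc j)
  then show ?case
    using qshift_nth[of j v] next_part_self[of j v] next_part_Suc[of v j] by (simp add: psum_Suc)
qed simp

text \<open>After a nonzero entry the two bounds coincide and pin the partial sum; just before it
  the upper bound is at least one unit short, which forces \<open>g\<close> to be nonzero
  there.\<close>

lemma atom_set_dominated:
  assumes len: "length g = length v" and sums: "sum_list g = sum_list v"
  shows "dominated g (qshift v) \<and> dominated v g \<longleftrightarrow> g \<in> atom_set v"
proof
  assume dom: "dominated g (qshift v) \<and> dominated v g"
  have up: "psum g j \<le> psum (qshift v) j" and lo: "psum v j \<le> psum g j" if "j \<le> length v" for j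
    using dom that len by (auto simp: dominated_iff)
  have "g ! i \<noteq> 0 \<and> psum g (Suc i) = psum v (Suc i)" if i: "i < length v" "v ! i \<noteq> 0" for i
  proof -
    have eq: "psum g (Suc i) = psum v (Suc i)"
      using up[of "Suc i"] lo[of "Suc i"] i psum_qshift[of "Suc i" v] by simp
    have "psum (qshift v) i < psum v (Suc i)"
      using psum_qshift[of i v] next_part_self[OF i] i by (simp add: psum_Suc)
    then have "psum g i < psum g (Suc i)" using up[of i] eq i by simp
    then show ?thesis using eq i len by (simp add: psum_Suc)
  qed
  then show "g \<in> atom_set v" using len sums by (simp add: atom_set_def)
next
  assume g: "g \<in> atom_set v"
  have lo: "psum v j \<le> psum g j" if "j \<le> length v" for j
    using slide_set_psum_le[of g v j] g atom_set_subset_slide_set that by blast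
  have "psum g j \<le> psum (qshift v) j" if j: "j \<le> length v" for j
  proof (cases "j = 0 \<or> v ! (j - 1) \<noteq> 0")
    case True
    then show ?thesis
    proof (cases "j = 0")
      case False
      then have "j - 1 < length v" "v ! (j - 1) \<noteq> 0" using True j by auto
      then have "psum g (Suc (j - 1)) = psum v (Suc (j - 1))"
        using g unfolding atom_set_def by blast
      then show ?thesis using False True psum_qshift[OF j] by simp
    qed simp
  next
    case False
    let ?S = "{i. i < length v \<and> v ! i \<noteq> 0 \<and> j \<le> i}"
    show ?thesis
    proof (cases "?S = {}")
      case True
      \<comment> \<open>With no part left, \<open>v\<close> has reached its total, which bounds
        every partial sum of \<open>g\<close>.\<close>
      then have "psum v (length v) \<le> psum v j" by (intro psum_gap) auto
      then show ?thesis using psum_le[of j g] sums psum_qshift[OF j] by simp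
    next
      case ne: False
      define i where "i = Min ?S"
      have "i \<in> ?S" unfolding i_def by (rule Min_in) (use ne in auto)
      then have i: "i < length v" "v ! i \<noteq> 0" "j \<le> i" by auto
      have "v ! k = 0" if "j \<le> k" "k < i" "k < length v" for k
      proof (rule ccontr)
        assume "v ! k \<noteq> 0"
        then have "i \<le> k" unfolding i_def using that by (intro Min_le) auto
        then show False using that by simp
      qed
      then have "psum v i \<le> psum v j" by (rule psum_gap)
      moreover have "next_part v j = v ! i - 1"
        unfolding next_part_def Let_def i_def using ne by (simp only: if_False)
      moreover have "psum g j < psum v (Suc i)"
      proof -
        have gi: "g ! i \<noteq> 0" "psum g (Suc i) = psum v (Suc i)" using g i by (auto simp: atom_set_def)
        have "psum g j \<le> psum g i" using i(3) by (rule psum_mono)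
        also have "\<dots> < psum g (Suc i)" using gi i len by (simp add: psum_Suc)
        finally show ?thesis using gi by simp
      qed
      ultimately show ?thesis using psum_qshift[OF j] False i by (simp add: psum_Suc)
    qed
  qed
  then show "dominated g (qshift v) \<and> dominated v g"
    using lo len by (simp add: dominated_iff)
qed

section \<open>Slide conditions as dominance and refinement\<close>

lemma slide_set_dominated: "g \<in> slide_set v \<Longrightarrow> dominated v g"
  using slide_set_psum_le by (simp add: dominated_iff)

text \<open>Cut \<open>\<mu>\<close> where its partial sum reaches the first part of
  \<open>\<nu>\<close> and recurse on the rest, whose partial sums are shifted by that part.\<close>

lemma refinesI_psum:
  assumes "0 \<notin> set \<mu>" and "sum_list \<mu> = sum_list \<nu>"
    and "\<And>i. i \<le> length \<nu> \<Longrightarrow> \<exists>j \<le> length \<mu>. psum \<mu> j = psum \<nu> i"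
  shows "refines \<mu> \<nu>"
  using assms
proof (induction \<nu> arbitrary: \<mu>)
  case Nil
  then have "\<mu> = []" by (cases \<mu>) auto
  then show ?case by (simp add: refines_def)
next
  case (Cons a \<nu>)
  obtain j where j: "j \<le> length \<mu>" "psum \<mu> j = a" using Cons.prems(3)[of 1] by auto
  have sum: "sum_list \<mu> = a + sum_list (drop j \<mu>)"
    using j by (metis append_take_drop_id sum_list_append)
  have "refines (drop j \<mu>) \<nu>"
  proof (rule Cons.IH)
    show "0 \<notin> set (drop j \<mu>)" using Cons.prems(1) by (meson in_set_dropD)
    show "sum_list (drop j \<mu>) = sum_list \<nu>" using sum Cons.prems(2) by simp
    fix i assume "i \<le> length \<nu>"
    then obtain k where k: "k \<le> length \<mu>" "psum \<mu> k = a + psum \<nu> i"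
      using Cons.prems(3)[of "Suc i"] by auto
    \<comment> \<open>If \<open>k\<close> lies before \<open>j\<close>, both partial sums equal
      \<open>a\<close> and \<open>j\<close> serves equally well; the maximum keeps the index inside
      the dropped tail.\<close>
    define m where "m = max j k"
    have m: "j \<le> m" "m \<le> length \<mu>" using j k by (auto simp: m_def)
    have "psum \<mu> m = a + psum \<nu> i"
    proof (cases "j \<le> k")
      case False
      then have "psum \<mu> k \<le> psum \<mu> j" by (intro psum_mono) simp
      then show ?thesis using False j k by (simp add: m_def max_def)
    qed (use k in \<open>simp add: m_def max_def\<close>)
    moreover have "psum \<mu> m = psum \<mu> j + psum (drop j \<mu>) (m - j)"
      using m by (metis le_add_diff_inverse sum_list_append take_add)
    ultimately show "\<exists>k \<le> length (drop j \<mu>). psum (drop j \<mu>) k = psum \<nu> i"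
      using j m by (intro exI[of _ "m - j"]) simp
  qed
  then obtain \<mu>s where \<mu>s: "concat \<mu>s = drop j \<mu>" "map sum_list \<mu>s = \<nu>"
    by (auto simp: refines_def)
  show ?case unfolding refines_def
    by (rule exI[of _ "take j \<mu> # \<mu>s"]) (use \<mu>s j in simp)
qed

lemma sum_list_strong [simp]: "sum_list (strong v) = sum_list v"
  by (induction v) (simp_all add: strong_def)

lemma psum_strong:
  assumes "j \<le> length g"
  shows "\<exists>k \<le> length (strong g). psum (strong g) k = psum g j"
proof -
  have "strong g = strong (take j g) @ strong (drop j g)"
    by (metis append_take_drop_id filter_append strong_def)
  then have "take (length (strong (take j g))) (strong g) = strong (take j g)"
    and "length (strong (take j g)) \<le> length (strong g)"
    by simp_all
  then show ?thesis using sum_list_strong[of "take j g"] by metis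
qed

lemma psum_of_strong:
  "i \<le> length (strong v) \<Longrightarrow> \<exists>j \<le> length v. psum v j = psum (strong v) i"
proof (induction v arbitrary: i)
  case (Cons a v)
  show ?case
  proof (cases "a = 0")
    case True
    then obtain j where "j \<le> length v" "psum v j = psum (strong v) i"
      using Cons by (auto simp: strong_def)
    then show ?thesis using True by (intro exI[of _ "Suc j"]) (simp add: strong_def)
  next
    case False
    show ?thesis
    proof (cases i)
      case 0
      then show ?thesis by (intro exI[of _ 0]) simp
    next
      case (Suc k)
      then obtain j where "j \<le> length v" "psum v j = psum (strong v) k"
        using Cons False by (auto simp: strong_def)
      then show ?thesis using False Suc by (intro exI[of _ "Suc j"]) (simp add: strong_def)
    qed
  qed
qed (simp add: strong_def)

lemma slide_set_refines:
  assumes g: "g \<in> slide_set v"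
  shows "refines (strong g) (strong v)"
proof (rule refinesI_psum)
  show "0 \<notin> set (strong g)" by (simp add: strong_def)
  show "sum_list (strong g) = sum_list (strong v)" using g by (simp add: slide_set_def)
  fix i assume "i \<le> length (strong v)"
  then obtain i' where i': "i' \<le> length v" "psum v i' = psum (strong v) i"
    using psum_of_strong by blast
  then obtain j where "j \<le> i'" "psum g j = psum v i'" using g by (auto simp: slide_set_def)
  then show "\<exists>j \<le> length (strong g). psum (strong g) j = psum (strong v) i"
    using psum_strong[of j g] i' g by (auto simp: slide_set_def)
qed

subsection \<open>Words\<close>

text \<open>The run index serves as the position. Empty runs contribute no pair and appear only as
  skipped positions.\<close>

definition tagged :: "nat list list \<Rightarrow> (nat \<times> nat) list" where
  "tagged R = zip (positions (map length R)) (concat R)"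

lemma length_concat_positions: "length (positions (map length R)) = length (concat R)"
  by (simp add: length_concat)

lemma map_fst_tagged: "map fst (tagged R) = positions (map length R)"
  and map_snd_tagged: "map snd (tagged R) = concat R"
  using length_concat_positions[of R] by (simp_all add: tagged_def)

lemma tagged_Nil [simp]: "tagged [] = []"
  by (simp add: tagged_def)

lemma tagged_snoc: "tagged (R @ [r]) = tagged R @ map (Pair (length R)) r"
proof -
  have "zip (replicate (length r) k) r = map (Pair k) r" for k :: nat
    by (rule nth_equalityI) simp_all
  then show ?thesis using length_concat_positions[of R] by (simp add: tagged_def)
qed

lemma tagged_Cons: "tagged (r # R) = map (Pair 0) r @ map (apfst Suc) (tagged R)"
proof (induction R rule: rev_induct)
  case Nil
  show ?case using tagged_snoc[of "[]" r] by simp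
next
  case (snoc x R)
  then show ?case using tagged_snoc[of "r # R" x] tagged_snoc[of R x] by simp
qed

lemma positions_filter:
  "positions (map (\<lambda>r. length (filter P r)) R) = map fst (filter (\<lambda>x. P (snd x)) (tagged R))"
proof (induction R rule: rev_induct)
  case (snoc r R)
  have "map fst (filter (\<lambda>x. P (snd x)) (map (Pair k) r)) = replicate (length (filter P r)) k"
    for k :: nat
    by (induction r) simp_all
  then show ?case using snoc by (simp add: tagged_snoc)
qed simp

text \<open>Trailing empty runs leave no trace in \<open>tagged\<close>, so the number of runs has
  to be given.\<close>

lemma tagged_inject:
  assumes "length R = length R'" and "tagged R = tagged R'"
  shows "R = R'"
proof -
  have "map length R = map length R'"
    using positions_inject[of "map length R" "map length R'"] assms map_fst_tagged by (metis length_map)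
  moreover have "concat R = concat R'" using assms map_snd_tagged by metis
  ultimately show ?thesis
  proof (induction R arbitrary: R')
    case (Cons r R)
    then show ?case by (cases R') auto
  qed simp
qed

lemma ex_chunks: "length C = sum_list v \<Longrightarrow> \<exists>R. map length R = v \<and> concat R = C"
proof (induction v arbitrary: C)
  case Nil
  then show ?case by (intro exI[of _ "[]"]) simp
next
  case (Cons a v)
  then obtain R where "map length R = v" "concat R = drop a C"
    by (metis add_diff_cancel_left' length_drop sum_list.Cons)
  then show ?case using Cons.prems by (intro exI[of _ "take a C # R"]) simp
qed

text \<open>The head of \<open>concat R\<close> is the next letter beyond any empty runs, so one
  comparison covers both plain descents and descents across stars.\<close>

fun run_list :: "nat list list \<Rightarrow> bool" where
  "run_list [] \<longleftrightarrow> True"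
| "run_list (r # R) \<longleftrightarrow>
    sorted r \<and> (r \<noteq> [] \<longrightarrow> concat R \<noteq> [] \<longrightarrow> last r > hd (concat R)) \<and> run_list R"

lemma successively_tight_tagged: "successively tight (tagged R) \<longleftrightarrow> run_list R"
proof (induction R)
  case (Cons r R)
  have r: "successively tight (map (Pair 0) r) \<longleftrightarrow> sorted r"
    by (simp add: successively_map tight_def successively_conv_sorted_wrt)
  have R: "successively tight (map (apfst Suc) (tagged R)) \<longleftrightarrow> successively tight (tagged R)"
    by (simp add: successively_map tight_def)
  have empty: "tagged R = [] \<longleftrightarrow> concat R = []"
    by (metis map_is_Nil_conv map_snd_tagged)
  have "tight (last (map (Pair 0) r)) (hd (map (apfst Suc) (tagged R))) \<longleftrightarrow> last r > hd (concat R)"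
    if "r \<noteq> []" "concat R \<noteq> []"
  proof -
    have "tagged R \<noteq> []" using empty that by simp
    moreover from this have "snd (hd (tagged R)) = hd (concat R)"
      by (metis hd_map map_snd_tagged)
    ultimately show ?thesis using that by (simp add: last_map hd_map tight_def)
  qed
  then show ?case
    unfolding tagged_Cons successively_append_iff r R run_list.simps Cons
    by (auto simp: empty)
qed simp

section \<open>Words and their lists of runs\<close>

definition letters :: "word \<Rightarrow> nat list" where
  "letters D = map the (filter (\<lambda>x. x \<noteq> None) D)"

definition word_of :: "nat list list \<Rightarrow> word" where
  "word_of R = concat (map (\<lambda>r. if r = [] then [None] else map Some r) R)"

lemma runs_Some: "\<exists>r R. runs (Some b # D) = (b # r) # R"
proof (cases D)
  case (Cons x D')
  then show ?thesis by (cases x) auto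
qed simp

lemma concat_runs: "concat (runs D) = letters D"
proof (induction D rule: runs.induct)
  case (3 a b D)
  obtain r R where "runs (Some b # D) = (b # r) # R" using runs_Some by blast
  then show ?case using 3 by (auto simp: letters_def)
qed (simp_all add: letters_def)

lemma word_of_runs: "word_of (runs D) = D"
proof (induction D rule: runs.induct)
  case (3 a b D)
  obtain r R where "runs (Some b # D) = (b # r) # R" using runs_Some by blast
  then show ?case using 3 by (auto simp: word_of_def)
qed (simp_all add: word_of_def)

lemma letters_word_of: "letters (word_of R) = concat R"
  by (induction R) (auto simp: word_of_def letters_def filter_map o_def)

lemma star_descents_Cons_None: "star_descents (None # D) \<longleftrightarrow> star_descents D"
proof
  assume a: "star_descents (None # D)"
  show "star_descents D" unfolding star_descents_def
  proof (intro allI impI)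
    fix U V c d k assume D: "D = U @ Some c # replicate k None @ Some d # V \<and> 1 \<le> k"
    then have "None # D = (None # U) @ Some c # replicate k None @ Some d # V" by simp
    then show "d < c" using a D unfolding star_descents_def by blast
  qed
next
  assume a: "star_descents D"
  show "star_descents (None # D)" unfolding star_descents_def
  proof (intro allI impI)
    fix U V c d k assume D: "None # D = U @ Some c # replicate k None @ Some d # V \<and> 1 \<le> k"
    then obtain U' where "U = None # U'" by (cases U) auto
    then have "D = U' @ Some c # replicate k None @ Some d # V" using D by simp
    then show "d < c" using a D unfolding star_descents_def by blast
  qed
qed

lemma star_descents_Cons_Some: "star_descents (Some c # D) \<longleftrightarrow> star_descents D \<and>
    (\<forall>V d k. D = replicate k None @ Some d # V \<and> 1 \<le> k \<longrightarrow> d < c)"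
proof
  assume a: "star_descents (Some c # D)"
  have "star_descents D" unfolding star_descents_def
  proof (intro allI impI)
    fix U V e d k assume D: "D = U @ Some e # replicate k None @ Some d # V \<and> 1 \<le> k"
    then have "Some c # D = (Some c # U) @ Some e # replicate k None @ Some d # V" by simp
    then show "d < e" using a D unfolding star_descents_def by blast
  qed
  moreover have "d < c" if D: "D = replicate k None @ Some d # V \<and> 1 \<le> k" for V d k
  proof -
    have "Some c # D = [] @ Some c # replicate k None @ Some d # V" using D by simp
    then show ?thesis using a D unfolding star_descents_def by blast
  qed
  ultimately show "star_descents D \<and>
    (\<forall>V d k. D = replicate k None @ Some d # V \<and> 1 \<le> k \<longrightarrow> d < c)" by blast
next
  assume a: "star_descents D \<and>
    (\<forall>V d k. D = replicate k None @ Some d # V \<and> 1 \<le> k \<longrightarrow> d < c)"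
  show "star_descents (Some c # D)" unfolding star_descents_def
  proof (intro allI impI)
    fix U V e d k assume D: "Some c # D = U @ Some e # replicate k None @ Some d # V \<and> 1 \<le> k"
    show "d < e"
    proof (cases U)
      case Nil
      then have "D = replicate k None @ Some d # V" "e = c" using D by simp_all
      then show ?thesis using a D by blast
    next
      case (Cons u U')
      then have "D = U' @ Some e # replicate k None @ Some d # V" using D by simp
      then show ?thesis using a D unfolding star_descents_def by blast
    qed
  qed
qed

lemma stars_then_letter:
  "letters D \<noteq> [] \<Longrightarrow> \<exists>k V. D = replicate k None @ Some (hd (letters D)) # V"
proof (induction D)
  case (Cons x D)
  show ?case
  proof (cases x)
    case None
    then have "letters (x # D) = letters D" by (simp add: letters_def)
    then obtain k V where "D = replicate k None @ Some (hd (letters (x # D))) # V"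
      using Cons by metis
    then have "x # D = replicate (Suc k) None @ Some (hd (letters (x # D))) # V"
      using None by simp
    then show ?thesis by blast
  next
    case (Some a)
    then have "x # D = replicate 0 None @ Some (hd (letters (x # D))) # D"
      by (simp add: letters_def)
    then show ?thesis by blast
  qed
qed (simp add: letters_def)

text \<open>A cut between adjacent letters is a descent by the definition of \<open>runs\<close>; a
  cut at stars between letters is one by \<open>star_descents\<close>.\<close>

lemma run_list_runs: "star_descents D \<Longrightarrow> run_list (runs D)"
proof (induction D rule: runs.induct)
  case (2 D)
  then show ?case by (simp add: star_descents_Cons_None)
next
  case (3 a b D)
  obtain r R where rR: "runs (Some b # D) = (b # r) # R" using runs_Some by blast
  have "run_list ((b # r) # R)"
    using 3 rR by (cases "a \<le> b") (auto simp: star_descents_Cons_Some[of a])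
  then show ?case using rR by (cases "a \<le> b") auto
next
  case ("4_2" a D)
  have "star_descents (None # D)" using "4_2"(2) by (simp only: star_descents_Cons_Some)
  then have R: "run_list (runs (None # D))" by (rule "4_2"(1))
  have "hd (letters (None # D)) < a" if ne: "letters (None # D) \<noteq> []"
  proof -
    obtain k V where D: "None # D = replicate k None @ Some (hd (letters (None # D))) # V"
      using stars_then_letter[OF ne] by blast
    then have "1 \<le> k" by (cases k) auto
    then show ?thesis using "4_2"(2) D unfolding star_descents_Cons_Some by blast
  qed
  then show ?case using R concat_runs[of "None # D"] by (simp del: runs.simps(2) add: runs.simps(5))
qed simp_all

lemma runs_append:
  assumes "r \<noteq> []" and "sorted r" and "\<And>d E'. E = Some d # E' \<Longrightarrow> d < last r"
  shows "runs (map Some r @ E) = r # runs E"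
  using assms
proof (induction r)
  case (Cons a r)
  show ?case
  proof (cases r)
    case Nil
    show ?thesis
    proof (cases E)
      case (Cons x E')
      then show ?thesis using Cons.prems(3) Nil by (cases x) auto
    qed (use Nil in simp)
  next
    case (Cons b r')
    then have "runs (map Some r @ E) = r # runs E" using Cons.IH Cons.prems by auto
    then show ?thesis using Cons Cons.prems by simp
  qed
qed simp

text \<open>With \<open>word_of_runs\<close>, \<open>run_list_runs\<close> and
  \<open>star_descents_word_of\<close> this makes \<open>runs\<close> a bijection from the words
  satisfying \<open>star_descents\<close> onto the lists satisfying \<open>run_list\<close>.\<close>

lemma runs_word_of: "run_list R \<Longrightarrow> runs (word_of R) = R"
proof (induction R)
  case Nil
  show ?case by (simp add: word_of_def)
next
  case (Cons r R)
  show ?case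
  proof (cases "r = []")
    case True
    then show ?thesis using Cons by (simp add: word_of_def)
  next
    case False
    have "d < last r" if "word_of R = Some d # E'" for d E'
    proof -
      have "concat R = d # letters E'" using that letters_word_of[of R] by (simp add: letters_def)
      then show ?thesis using Cons.prems False by simp
    qed
    then have "runs (map Some r @ word_of R) = r # runs (word_of R)"
      using False Cons.prems by (intro runs_append) auto
    then show ?thesis using Cons False by (simp add: word_of_def)
  qed
qed

lemma star_descents_append:
  assumes "star_descents E" and "letters E \<noteq> [] \<Longrightarrow> hd (letters E) < last r" and "r \<noteq> []"
  shows "star_descents (map Some r @ E)"
  using assms(2,3)
proof (induction r)
  case (Cons a r)
  have "d < a" if D: "map Some r @ E = replicate k None @ Some d # V \<and> 1 \<le> k" for V d k
  proof (cases r)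
    case Nil
    then have "letters E = d # letters V" using D by (simp add: letters_def)
    then show ?thesis using Cons.prems Nil by simp
  next
    case (Cons b r')
    then show ?thesis using D by (cases k) auto
  qed
  moreover have "star_descents (map Some r @ E)"
    using Cons assms(1) by (cases "r = []") auto
  ultimately show ?case unfolding list.map append_Cons star_descents_Cons_Some by blast
qed simp

lemma star_descents_word_of: "run_list R \<Longrightarrow> star_descents (word_of R)"
proof (induction R)
  case Nil
  show ?case by (simp add: word_of_def star_descents_def)
next
  case (Cons r R)
  show ?case
  proof (cases "r = []")
    case True
    then show ?thesis using Cons by (simp add: word_of_def star_descents_Cons_None)
  next
    case False
    then have "star_descents (map Some r @ word_of R)"
      using Cons by (intro star_descents_append) (auto simp: letters_word_of)
    then show ?thesis using False by (simp add: word_of_def)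
  qed
qed

section \<open>Shuffles and membership in \<open>qSSet\<close>\<close>

lemma letters_Some: "filter (\<lambda>x. x \<noteq> None) D = map Some (letters D)"
  by (induction D) (auto simp: letters_def)

text \<open>Parity marks the origin of each letter, so a shuffle of the two words is exactly a list
  whose parity filters return them; the stars may stand anywhere and their number is free.\<close>

lemma shuffle_words_iff:
  assumes A: "\<forall>l \<in> set A. odd l" and B: "\<forall>l \<in> set B. even l"
  shows "(\<exists>k. \<exists>C \<in> shuffles (map Some A) (map Some B). D \<in> shuffles C (replicate k None))
    \<longleftrightarrow> filter odd (letters D) = A \<and> filter even (letters D) = B"
proof
  assume "\<exists>k. \<exists>C \<in> shuffles (map Some A) (map Some B). D \<in> shuffles C (replicate k None)"
  then obtain k C where C: "C \<in> shuffles (map Some A) (map Some B)"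
    and D: "D \<in> shuffles C (replicate k None)" by blast
  have sC: "set C \<subseteq> Some ` (set A \<union> set B)" using set_shuffles[OF C] by auto
  have "filter (\<lambda>x. x \<noteq> None) D \<in> shuffles (filter (\<lambda>x. x \<noteq> None) C) (filter (\<lambda>x. x \<noteq> None) (replicate k None))"
    using D filter_shuffles by blast
  moreover have "filter (\<lambda>x. x \<noteq> None) C = C" using sC by (auto simp: filter_id_conv)
  ultimately have DC: "filter (\<lambda>x. x \<noteq> None) D = C" by simp
  have "filter (\<lambda>x. odd (the x)) C
      \<in> shuffles (filter (\<lambda>x. odd (the x)) (map Some A)) (filter (\<lambda>x. odd (the x)) (map Some B))"
    using C filter_shuffles by blast
  moreover have "filter (\<lambda>x. odd (the x)) (map Some A) = map Some A"
      "filter (\<lambda>x. odd (the x)) (map Some B) = []"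
    using A B by (auto simp: filter_id_conv filter_empty_conv)
  ultimately have 1: "filter (\<lambda>x. odd (the x)) C = map Some A" by simp
  have "filter (\<lambda>x. even (the x)) C
      \<in> shuffles (filter (\<lambda>x. even (the x)) (map Some A)) (filter (\<lambda>x. even (the x)) (map Some B))"
    using C filter_shuffles by blast
  moreover have "filter (\<lambda>x. even (the x)) (map Some A) = []"
      "filter (\<lambda>x. even (the x)) (map Some B) = map Some B"
    using A B by (auto simp: filter_id_conv filter_empty_conv)
  ultimately have 2: "filter (\<lambda>x. even (the x)) C = map Some B" by simp
  have "C = map Some (letters D)" using DC letters_Some by metis
  then have "map Some (filter odd (letters D)) = map Some A"
      "map Some (filter even (letters D)) = map Some B"
    using 1 2 by (simp_all add: filter_map o_def)
  moreover have "inj (map (Some :: nat \<Rightarrow> nat option))" by simp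
  ultimately show "filter odd (letters D) = A \<and> filter even (letters D) = B"
    by (simp add: inj_eq)
next
  assume f: "filter odd (letters D) = A \<and> filter even (letters D) = B"
  let ?C = "map Some (letters D)"
  have "?C \<in> shuffles (filter (\<lambda>x. odd (the x)) ?C) (filter (\<lambda>x. \<not> odd (the x)) ?C)"
    by (rule partition_in_shuffles)
  then have "?C \<in> shuffles (map Some A) (map Some B)" using f by (simp add: filter_map o_def)
  moreover have "filter (\<lambda>x. \<not> x \<noteq> None) D = replicate (length (filter (\<lambda>x. \<not> x \<noteq> None) D)) None"
    by (rule replicate_length_same[symmetric]) auto
  then have "D \<in> shuffles ?C (replicate (length (filter (\<lambda>x. \<not> x \<noteq> None) D)) None)"
    using partition_in_shuffles[of D "\<lambda>x. x \<noteq> None"] unfolding letters_Some by metis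
  ultimately show "\<exists>k. \<exists>C \<in> shuffles (map Some A) (map Some B). D \<in> shuffles C (replicate k None)"
    by blast
qed

lemma positions_Des: "positions (Des D) = map fst (tagged (runs D))"
  by (simp add: Des_def map_fst_tagged)

lemma positions_Des_A: "positions (Des_A D) = map fst (odd_part (tagged (runs D)))"
  unfolding Des_A_def odd_part_def by (rule positions_filter)

lemma positions_Des_B: "positions (Des_B D) = map fst (even_part (tagged (runs D)))"
  unfolding Des_B_def even_part_def by (rule positions_filter)

text \<open>The dominance and refinement conditions make \<open>Des_A D\<close> a slide vector of
  \<open>\<alpha>\<close> and \<open>Des_B D\<close> an atom vector of \<open>\<beta>\<close>; with
  run indices as positions, the two together are admissibility.\<close>

lemma qSSet_iff:
  assumes len: "length \<beta> = length \<alpha>"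
  shows "D \<in> qSSet \<alpha> \<beta> \<longleftrightarrow>
    length (runs D) = length \<alpha> \<and> star_descents D \<and> tagged (runs D) \<in> fillings \<alpha> \<beta>"
proof -
  let ?L = "tagged (runs D)" and ?n = "length \<alpha>"
  let ?dom = "refines (strong (Des_A D)) (strong \<alpha>) \<and> dominated \<alpha> (Des_A D) \<and>
    dominated (Des_B D) (qshift \<beta>) \<and> dominated \<beta> (Des_B D)"
  let ?parts = "filter odd (letters D) = A_letters \<alpha> \<and> filter even (letters D) = B_letters \<beta>"
  have "D \<in> qSSet \<alpha> \<beta> \<longleftrightarrow> ?parts \<and> length (runs D) = ?n \<and> star_descents D \<and> ?dom"
    unfolding qSSet_def mem_Collect_eq A_word_letters B_word_letters
    using shuffle_words_iff[of "A_letters \<alpha>" "B_letters \<beta>" D] A_letter B_letter by blast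
  moreover have "?dom \<longleftrightarrow> admissible ?n ?L"
    if parts: ?parts and n: "length (runs D) = ?n" and stars: "star_descents D"
  proof -
    have s: "sorted ?L"
      using successively_tight_tagged run_list_runs[OF stars] tight_iff by blast
    then have s': "sorted (odd_part ?L)" "sorted (even_part ?L)"
      by (simp_all add: odd_part_def even_part_def sorted_wrt_filter)
    have snds: "map snd (odd_part ?L) = A_letters \<alpha>" "map snd (even_part ?L) = B_letters \<beta>"
      using parts by (simp_all add: map_snd_odd_part map_snd_even_part map_snd_tagged concat_runs)
    have zips: "zip (positions (Des_A D)) (A_letters \<alpha>) = odd_part ?L"
        "zip (positions (Des_B D)) (B_letters \<beta>) = even_part ?L"
      unfolding positions_Des_A positions_Des_B snds[symmetric] by (simp_all add: zip_map_fst_snd)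
    have lens: "length (Des_A D) = length \<alpha>" "length (Des_B D) = length \<beta>"
      using n len by (simp_all add: Des_A_def Des_B_def)
    have sums: "sum_list (Des_A D) = sum_list \<alpha>" "sum_list (Des_B D) = sum_list \<beta>"
      using snds positions_Des_A[of D] positions_Des_B[of D]
      by (metis length_A_letters length_map length_positions,
          metis length_B_letters length_map length_positions)
    have A: "Des_A D \<in> slide_set \<alpha> \<longleftrightarrow> (\<forall>(p, l) \<in> set (odd_part ?L). p \<le> part_index ?n l)"
      using slide_set_A_letters[OF lens(1) sums(1)] s' by (simp add: zips)
    have B: "Des_B D \<in> atom_set \<beta> \<longleftrightarrow> admissible ?n (even_part ?L)"
      using atom_set_B_letters[OF lens(2) sums(2)] s' len by (simp add: zips)
    have slide: "Des_A D \<in> slide_set \<alpha> \<longleftrightarrow>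
        refines (strong (Des_A D)) (strong \<alpha>) \<and> dominated \<alpha> (Des_A D)"
    proof
      assume "Des_A D \<in> slide_set \<alpha>"
      then show "refines (strong (Des_A D)) (strong \<alpha>) \<and> dominated \<alpha> (Des_A D)"
        using slide_set_refines slide_set_dominated by blast
    next
      assume "refines (strong (Des_A D)) (strong \<alpha>) \<and> dominated \<alpha> (Des_A D)"
      then have "\<forall>k < sum_list \<alpha>. positions (Des_A D) ! k \<le> positions \<alpha> ! k"
        using dominated_positions[OF lens(1) sums(1)] by blast
      \<comment> \<open>Letters drop between different parts of \<open>\<alpha>\<close>, so in the
        sorted odd part such neighbours lie in different runs; this is the strictness condition of
        \<open>slide_set_iff\<close>.\<close>
      moreover have "\<forall>k. Suc k < sum_list \<alpha> \<longrightarrow> positions \<alpha> ! k < positions \<alpha> ! Suc k \<longrightarrow>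
          positions (Des_A D) ! k < positions (Des_A D) ! Suc k"
        using s'(1) sorted_zip_positions_iff[OF sums(1), of "\<lambda>p. 2 * (?n - p) - 1"]
        unfolding zips(1)[symmetric] A_letters_def by simp
      ultimately show "Des_A D \<in> slide_set \<alpha>" using slide_set_iff[OF lens(1) sums(1)] by blast
    qed
    show ?thesis
      using A B slide atom_set_dominated[OF lens(2) sums(2)] admissible_iff_parts[of ?n ?L] by blast
  qed
  moreover have "?L \<in> fillings \<alpha> \<beta> \<longleftrightarrow> ?parts \<and> admissible ?n ?L" if "star_descents D"
    using successively_tight_tagged run_list_runs[OF that] tight_iff
    by (auto simp: fillings_def map_snd_tagged concat_runs)
  ultimately show ?thesis by blast
qed

lemma bij_betw_qSSet:
  assumes len: "length \<beta> = length \<alpha>"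
  shows "bij_betw (\<lambda>D. tagged (runs D)) (qSSet \<alpha> \<beta>) {Q \<in> fillings \<alpha> \<beta>. successively tight Q}"
proof (rule bij_betw_imageI)
  show "inj_on (\<lambda>D. tagged (runs D)) (qSSet \<alpha> \<beta>)"
  proof (rule inj_onI)
    fix D D' assume "D \<in> qSSet \<alpha> \<beta>" "D' \<in> qSSet \<alpha> \<beta>" "tagged (runs D) = tagged (runs D')"
    then have "runs D = runs D'" by (intro tagged_inject) (simp_all add: qSSet_iff[OF len])
    then show "D = D'" using word_of_runs by metis
  qed
  show "(\<lambda>D. tagged (runs D)) ` qSSet \<alpha> \<beta> = {Q \<in> fillings \<alpha> \<beta>. successively tight Q}"
  proof (intro equalityI subsetI)
    fix Q assume "Q \<in> (\<lambda>D. tagged (runs D)) ` qSSet \<alpha> \<beta>"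
    then obtain D where D: "D \<in> qSSet \<alpha> \<beta>" "Q = tagged (runs D)" by blast
    then show "Q \<in> {Q \<in> fillings \<alpha> \<beta>. successively tight Q}"
      using run_list_runs[of D] by (simp add: qSSet_iff[OF len] successively_tight_tagged)
  next
    fix Q assume "Q \<in> {Q \<in> fillings \<alpha> \<beta>. successively tight Q}"
    then have Q: "Q \<in> fillings \<alpha> \<beta>" "successively tight Q" by simp_all
    have s: "sorted (map fst Q)" using Q(1) by (intro sorted_map_fst) (simp add: fillings_def)
    have less: "set (map fst Q) \<subseteq> {..<length \<alpha>}" using fillings_fst_less[OF Q(1) len] by auto
    let ?v = "counts (length \<alpha>) (map fst Q)"
    have "length (map snd Q) = sum_list ?v" using sum_list_counts[OF s less] by simp
    \<comment> \<open>Cut the letters of \<open>Q\<close> by their numbers at each position; a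
      position holding no letter yields an empty run, hence a star.\<close>
    then obtain R where R: "map length R = ?v" "concat R = map snd Q" using ex_chunks by blast
    have tR: "tagged R = Q"
      unfolding tagged_def R positions_counts[OF s less] by (simp add: zip_map_fst_snd)
    then have rl: "run_list R" using Q(2) successively_tight_tagged by blast
    have "length R = length \<alpha>" using arg_cong[OF R(1), of length] by simp
    then have "word_of R \<in> qSSet \<alpha> \<beta>"
      using Q(1) tR star_descents_word_of[OF rl] by (simp add: qSSet_iff[OF len] runs_word_of[OF rl])
    then show "Q \<in> (\<lambda>D. tagged (runs D)) ` qSSet \<alpha> \<beta>"
      using tR runs_word_of[OF rl] by (intro image_eqI[of _ _ "word_of R"]) simp_all
  qed
qed

theorem mainTheorem5:
  fixes \<alpha> \<beta> :: "nat list" and n :: nat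
  assumes "length \<alpha> = n" and "length \<beta> = n"
  shows "fundamental_slide \<alpha> * fundamental_atom \<beta>
         = (\<Sum>D \<in> qSSet \<alpha> \<beta>. fundamental_atom (Des D))"
proof -
  have len: "length \<beta> = length \<alpha>" using assms by simp
  let ?fibre = "\<lambda>Q. \<Sum>L\<in>{L \<in> fillings \<alpha> \<beta>. push L = Q}. weight L"
  have "fundamental_slide \<alpha> * fundamental_atom \<beta> = (\<Sum>L\<in>fillings \<alpha> \<beta>. weight L)"
    unfolding fundamental_slide_expansion fundamental_atom_expansion by (rule mono_sum_product[OF len])
  also have "\<dots> = (\<Sum>Q\<in>{Q \<in> fillings \<alpha> \<beta>. successively tight Q}. ?fibre Q)"
    by (rule sum_fillings_push[OF len])
  also have "\<dots> = (\<Sum>D\<in>qSSet \<alpha> \<beta>. ?fibre (tagged (runs D)))"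
    by (rule sum.reindex_bij_betw[OF bij_betw_qSSet[OF len], symmetric])
  also have "\<dots> = (\<Sum>D\<in>qSSet \<alpha> \<beta>. fundamental_atom (Des D))"
  proof (rule sum.cong[OF refl])
    fix D assume D: "D \<in> qSSet \<alpha> \<beta>"
    then have "tagged (runs D) \<in> fillings \<alpha> \<beta>" "successively tight (tagged (runs D))"
        "length (Des D) = length \<alpha>"
      using run_list_runs[of D] by (simp_all add: qSSet_iff[OF len] successively_tight_tagged Des_def)
    \<comment> \<open>The first components of the tagged runs form the position list of
      \<open>Des D\<close>, so the fibre sum is the expansion of its atom.\<close>
    then show "?fibre (tagged (runs D)) = fundamental_atom (Des D)"
      unfolding fundamental_atom_expansion
      by (intro sum_fillings_fibre[OF len]) (simp_all add: positions_Des)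
  qed
  finally show ?thesis .
qed

end
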